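(* Let ${\bf d}=(d_1,\ldots,d_n)$ be a degree sequence with all $d_i\ge 1$, and let ${\mathcal G}({\bf d})$ be the uniformly random simple graph on $[n]$ with degree sequence ${\bf d}$. Let $n_j=|\{i:d_i=j\}|$, $\Delta=\max_i d_i$, and $M_k=\sum_{i=1}^n (d_i)_k$ where $(x)_k=x(x-1)\cdots(x-k+1)$. Assume $\Delta^2=o(M_1)$. \begin{enumerate} \item[(a)] If $n_1=\omega(M_1/\sqrt{M_2})$ or $n_2=\omega(\sqrt{M_1^3/M_2})$, then asymptotically almost surely ${\mathcal G}({\bf d})$ is symmetric. \item[(b)] If there is a constant $c>0$ such that $n_1>cM_1/\sqrt{M_2}$ or $n_2>c\sqrt{M_1^3/M_2}$, then there exists $\delta=\delta(c)>0$ such that for all sufficiently large $n$, ${\mathbb P}({\mathcal G}({\bf d})\text{ is symmetric})>\delta$. \end{enumerate}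
   Context: Degree sequences are graphical with even sum. A graph is symmetric if it has a non-identity automorphism. Asymptotics are as $n\to\infty$; "asymptotically almost surely" means with probability tending to $1$; $a_n=o(b_n)$ means $a_n/b_n\to0$; $a_n=\omega(b_n)$ means $b_n=o(a_n)$ and $a_n>0$ for large $n$. *)

theory Defs
  imports "HOL-Probability.Probability" "HOL-Library.Landau_Symbols"
    "HOL-Combinatorics.Permutations"
begin

text \<open>A simple graph on the vertex set \<open>{1..n}\<close> is identified with its edge set.\<close>

definition simple_graph :: "nat \<Rightarrow> nat set set \<Rightarrow> bool" where
  "simple_graph n E \<longleftrightarrow> (\<forall>e\<in>E. e \<subseteq> {1..n} \<and> card e = 2)"

definition degree :: "nat set set \<Rightarrow> nat \<Rightarrow> nat" where
  "degree E v = card {e \<in> E. v \<in> e}"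

definition realizations :: "nat \<Rightarrow> (nat \<Rightarrow> nat) \<Rightarrow> nat set set set" where
  "realizations n d = {E. simple_graph n E \<and> (\<forall>v\<in>{1..n}. degree E v = d v)}"

lemma finite_realizations: "finite (realizations n d)"
proof (rule finite_subset)
  show "realizations n d \<subseteq> Pow (Pow {1..n})"
    by (auto simp: realizations_def simple_graph_def)
qed simp

definition graph_automorphism :: "nat \<Rightarrow> nat set set \<Rightarrow> (nat \<Rightarrow> nat) \<Rightarrow> bool" where
  "graph_automorphism n E \<pi> \<longleftrightarrow>
     \<pi> permutes {1..n} \<and> (\<forall>u\<in>{1..n}. \<forall>v\<in>{1..n}. {u, v} \<in> E \<longleftrightarrow> {\<pi> u, \<pi> v} \<in> E)"

definition symmetric_graph :: "nat \<Rightarrow> nat set set \<Rightarrow> bool" where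
  "symmetric_graph n E \<longleftrightarrow> (\<exists>\<pi>. graph_automorphism n E \<pi> \<and> \<pi> \<noteq> id)"

text \<open>The degrees are \<open>d 1, \<dots>, d n\<close>; values of \<open>d\<close> outside \<open>{1..n}\<close> are irrelevant.
  Being graphical implies that the degree sum is even.\<close>

definition degree_sequence :: "nat \<Rightarrow> (nat \<Rightarrow> nat) \<Rightarrow> bool" where
  "degree_sequence n d \<longleftrightarrow> realizations n d \<noteq> {}"

definition random_graph :: "nat \<Rightarrow> (nat \<Rightarrow> nat) \<Rightarrow> nat set set pmf" where
  "random_graph n d = pmf_of_set (realizations n d)"

definition prob_symmetric :: "nat \<Rightarrow> (nat \<Rightarrow> nat) \<Rightarrow> real" where
  "prob_symmetric n d = measure_pmf.prob (random_graph n d) {E. symmetric_graph n E}"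

definition degree_count :: "nat \<Rightarrow> nat \<Rightarrow> (nat \<Rightarrow> nat) \<Rightarrow> real" where
  "degree_count j n d = real (card {i \<in> {1..n}. d i = j})"

definition max_degree :: "nat \<Rightarrow> (nat \<Rightarrow> nat) \<Rightarrow> real" where
  "max_degree n d = real (Max (d ` {1..n}))"

definition falling_factorial :: "real \<Rightarrow> nat \<Rightarrow> real" where
  "falling_factorial x k = (\<Prod>j<k. x - real j)"

definition degree_moment :: "nat \<Rightarrow> nat \<Rightarrow> (nat \<Rightarrow> nat) \<Rightarrow> real" where
  "degree_moment k n d = (\<Sum>i=1..n. falling_factorial (real (d i)) k)"

text \<open>\<open>n \<rightarrow> \<infinity>\<close> along the lengths \<open>n \<in> I\<close> for which a degree sequence is given: parity
  may rule out some \<open>n\<close> (e.g. odd \<open>n\<close> for cubic graphs), and \<open>n = 1\<close> never occurs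
  when all degrees are positive.\<close>

definition along :: "nat set \<Rightarrow> nat filter" where
  "along I = inf sequentially (principal I)"

definition degree_family :: "nat set \<Rightarrow> (nat \<Rightarrow> nat \<Rightarrow> nat) \<Rightarrow> bool" where
  "degree_family I d \<longleftrightarrow> infinite I \<and>
     (\<forall>n\<in>I. degree_sequence n (d n) \<and> (\<forall>i\<in>{1..n}. d n i \<ge> 1)) \<and>
     (\<lambda>n. (max_degree n (d n))\<^sup>2) \<in> o[along I](\<lambda>n. degree_moment 1 n (d n))"

text \<open>Besides \<open>b = o(a)\<close>, positivity of \<open>a\<close> is part of the convention; the library's
  \<open>\<omega>\<close> does not demand it.\<close>

definition little_omega :: "nat filter \<Rightarrow> (nat \<Rightarrow> real) \<Rightarrow> (nat \<Rightarrow> real) \<Rightarrow> bool" where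
  "little_omega F a b \<longleftrightarrow> b \<in> o[F](a) \<and> eventually (\<lambda>n. a n > 0) F"

text \<open>If all degrees are 1, the second moment vanishes and both thresholds are 0 because
  \<open>x / 0 = 0\<close>. The graph is then a perfect matching, which is symmetric.\<close>

definition threshold1 :: "nat \<Rightarrow> (nat \<Rightarrow> nat) \<Rightarrow> real" where
  "threshold1 n d = degree_moment 1 n d / sqrt (degree_moment 2 n d)"

definition threshold2 :: "nat \<Rightarrow> (nat \<Rightarrow> nat) \<Rightarrow> real" where
  "threshold2 n d = sqrt (degree_moment 1 n d ^ 3 / degree_moment 2 n d)"

end

theory Submission
  imports Defs
begin

text \<open>
  A graph is symmetric if it contains two leaves with a common neighbour, or two adjacent vertices
  of degree 2 with a common neighbour. Let \<open>N\<close> be the set of realizations without such a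
  configuration and \<open>S\<close> the set of those with one. Given \<open>G \<in> N\<close>, pick a path \<open>x v y\<close>
  (\<open>M\<^sub>2\<close> choices) and two vertices \<open>a\<close>, \<open>b\<close> of degree 1 (or 2), and create the
  edges \<open>va\<close>, \<open>vb\<close> (and \<open>ab\<close>) one at a time, each by a switching that moves the edges
  \<open>ux\<close>, \<open>ws\<close>, \<open>pq\<close> to \<open>uw\<close>, \<open>xp\<close>, \<open>sq\<close>. There are about \<open>M\<^sub>1\<close> choices for
  \<open>pq\<close>, while undoing a switching costs at most \<open>M\<^sub>1\<^sup>2\<close> choices, namely of the arcs
  \<open>xp\<close> and \<open>sq\<close>; and a graph so obtained contains only boundedly many configurations, since it
  differs from a graph in \<open>N\<close> by boundedly many edges. Double counting bounds \<open>|N| / |S|\<close>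
  by a constant times \<open>M\<^sub>1\<^sup>2 / (n\<^sub>1\<^sup>2 M\<^sub>2)\<close>, respectively \<open>M\<^sub>1\<^sup>3 / (n\<^sub>2\<^sup>2 M\<^sub>2)\<close>.
  Hence constant-factor estimates give both parts, and no second moment is needed.
\<close>

section \<open>Neighbourhoods\<close>

definition nbrs :: "nat set set \<Rightarrow> nat \<Rightarrow> nat set" where
  "nbrs E v = {w. {v, w} \<in> E}"

text \<open>Ordered pairs, so every edge counts twice and a realization has exactly
  \<open>M1\<close> arcs, the degree sum.\<close>

definition arcs :: "nat set set \<Rightarrow> (nat \<times> nat) set" where
  "arcs E = {(v, w). {v, w} \<in> E}"

lemma simple_graph_edgeD:
  assumes "simple_graph n E" "{v, w} \<in> E"
  shows "v \<in> {1..n}" "w \<in> {1..n}" "v \<noteq> w"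
proof -
  have "{v, w} \<subseteq> {1..n}" and "card {v, w} = 2"
    using assms(1)[unfolded simple_graph_def, rule_format, OF assms(2)] by simp_all
  then show "v \<in> {1..n}" "w \<in> {1..n}" "v \<noteq> w" by auto
qed

lemma nbrs_iff: "z \<in> nbrs E c \<longleftrightarrow> {z, c} \<in> E"
  by (simp add: nbrs_def insert_commute)

lemma simple_graph_finite: "simple_graph n E \<Longrightarrow> finite E"
  by (rule finite_subset[of _ "Pow {1..n}"]) (auto simp: simple_graph_def)

lemma nbrs_subset: "simple_graph n E \<Longrightarrow> nbrs E v \<subseteq> {1..n}"
  unfolding nbrs_def by (intro subsetI, elim CollectE, rule simple_graph_edgeD(2))

lemma finite_nbrs: "simple_graph n E \<Longrightarrow> finite (nbrs E v)"
  by (rule finite_subset[OF nbrs_subset]) simp_all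

lemma card_nbrs:
  assumes "simple_graph n E"
  shows "card (nbrs E v) = degree E v"
proof -
  have "bij_betw (\<lambda>w. {v, w}) (nbrs E v) {e \<in> E. v \<in> e}"
  proof (rule bij_betw_imageI)
    show "inj_on (\<lambda>w. {v, w}) (nbrs E v)"
      by (auto simp: inj_on_def doubleton_eq_iff)
    show "(\<lambda>w. {v, w}) ` nbrs E v = {e \<in> E. v \<in> e}"
    proof (intro equalityI subsetI)
      fix e assume e: "e \<in> {e \<in> E. v \<in> e}"
      then have "card e = 2" using assms by (auto simp: simple_graph_def)
      then obtain x y where "e = {x, y}" by (auto simp: card_2_iff)
      with e have "e = {v, x} \<or> e = {v, y}" by auto
      with e show "e \<in> (\<lambda>w. {v, w}) ` nbrs E v" by (auto simp: nbrs_def)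
    qed (auto simp: nbrs_def)
  qed
  then show ?thesis by (simp add: bij_betw_same_card degree_def)
qed

lemma card_Sigma_ge:
  assumes "finite A" "\<And>x. x \<in> A \<Longrightarrow> finite (B x)" "\<And>x. x \<in> A \<Longrightarrow> k \<le> card (B x)"
  shows "card A * k \<le> card (Sigma A B)"
proof -
  have "card A * k = (\<Sum>x\<in>A. k)" by simp
  also have "\<dots> \<le> (\<Sum>x\<in>A. card (B x))" using assms by (intro sum_mono) auto
  finally show ?thesis using assms by (simp add: card_SigmaI)
qed

lemma card_Sigma_le:
  assumes "finite A" "\<And>x. x \<in> A \<Longrightarrow> finite (B x)" "\<And>x. x \<in> A \<Longrightarrow> card (B x) \<le> k"
  shows "card (Sigma A B) \<le> card A * k"
proof -
  have "(\<Sum>x\<in>A. card (B x)) \<le> (\<Sum>x\<in>A. k)" using assms by (intro sum_mono) auto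
  then show ?thesis using assms by (simp add: card_SigmaI)
qed

section \<open>Switchings\<close>

text \<open>The third edge \<open>pq\<close> makes the switching robust: in every realization all but
  \<open>O(\<Delta>\<^sup>2)\<close> arcs \<open>(p, q)\<close> are admissible, whereas the direct switching from
  \<open>ux\<close>, \<open>ws\<close> to \<open>uw\<close>, \<open>xs\<close> may be blocked by an edge \<open>xs\<close>.\<close>

definition switch :: "nat set set \<Rightarrow> nat \<Rightarrow> nat \<Rightarrow> nat \<Rightarrow> nat \<Rightarrow> nat \<Rightarrow> nat \<Rightarrow> nat set set" where
  "switch E u x w s p q = E - {{u, x}, {w, s}, {p, q}} \<union> {{u, w}, {x, p}, {s, q}}"

definition switchable :: "nat set set \<Rightarrow> nat \<Rightarrow> nat \<Rightarrow> nat \<Rightarrow> nat \<Rightarrow> nat \<Rightarrow> nat \<Rightarrow> bool" where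
  "switchable E u x w s p q \<longleftrightarrow> distinct [u, x, w, s, p, q] \<and>
     {u, x} \<in> E \<and> {w, s} \<in> E \<and> {p, q} \<in> E \<and> {u, w} \<notin> E \<and> {x, p} \<notin> E \<and> {s, q} \<notin> E"

text \<open>The three removed edges lie in \<open>E\<close> and the three added ones do not, so
  plain set operations undo the switching. This is what makes it injective once the six vertices are
  known.\<close>

lemma switch_inverse:
  assumes "switchable E u x w s p q"
  shows "switch E u x w s p q - {{u, w}, {x, p}, {s, q}} \<union> {{u, x}, {w, s}, {p, q}} = E"
proof -
  define R where "R = {{u, x}, {w, s}, {p, q}}"
  define A where "A = {{u, w}, {x, p}, {s, q}}"
  have "R \<subseteq> E" "A \<inter> E = {}"
    using assms by (simp_all add: R_def A_def switchable_def)
  then have "(E - R \<union> A) - A \<union> R = E" by blast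
  then show ?thesis by (simp add: switch_def R_def A_def)
qed

lemma sum_triple:
  fixes f :: "'a \<Rightarrow> nat"
  assumes "a \<noteq> b" "a \<noteq> c" "b \<noteq> c"
  shows "sum f {a, b, c} = f a + f b + f c"
  using assms by simp

text \<open>The removed and the added triple are both perfect matchings of the same six vertices, so
  each of these vertices loses one edge and gains one.\<close>

lemma degree_switch:
  assumes "switchable E u x w s p q" "finite E"
  shows "degree (switch E u x w s p q) t = degree E t"
proof -
  define R where "R = {{u, x}, {w, s}, {p, q}}"
  define A where "A = {{u, w}, {x, p}, {s, q}}"
  let ?at = "\<lambda>F. {e \<in> F. t \<in> e}"
  have sub: "R \<subseteq> E" "A \<inter> E = {}" and fin: "finite R" "finite A"
    using assms by (simp_all add: R_def A_def switchable_def)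
  have dist: "distinct [u, x, w, s, p, q]" using assms by (simp add: switchable_def)
  have filter: "card (?at F) = (\<Sum>e\<in>F. of_bool (t \<in> e))" if "finite F" for F
    using that by (simp add: Collect_conj_eq)
  have pair: "of_bool (t \<in> {a, b}) = (of_bool (t = a) + of_bool (t = b) :: nat)" if "a \<noteq> b" for a b
    using that by auto
  have R_dist: "{u, x} \<noteq> {w, s}" "{u, x} \<noteq> {p, q}" "{w, s} \<noteq> {p, q}"
    and A_dist: "{u, w} \<noteq> {x, p}" "{u, w} \<noteq> {s, q}" "{x, p} \<noteq> {s, q}"
    using dist by (simp_all add: doubleton_eq_iff)
  have "card (?at R) = of_bool (t \<in> {u, x}) + of_bool (t \<in> {w, s}) + of_bool (t \<in> {p, q})"
    unfolding filter[OF fin(1)] unfolding R_def by (rule sum_triple[OF R_dist])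
  moreover have "card (?at A) = of_bool (t \<in> {u, w}) + of_bool (t \<in> {x, p}) + of_bool (t \<in> {s, q})"
    unfolding filter[OF fin(2)] unfolding A_def by (rule sum_triple[OF A_dist])
  moreover have "u \<noteq> x" "w \<noteq> s" "p \<noteq> q" "u \<noteq> w" "x \<noteq> p" "s \<noteq> q"
    using dist by simp_all
  ultimately have cards: "card (?at R) = card (?at A)"
    by (simp only: pair not_False_eq_True ac_simps)
  have "?at (switch E u x w s p q) = (?at E - ?at R) \<union> ?at A"
    by (auto simp: switch_def R_def A_def)
  moreover have "card ((?at E - ?at R) \<union> ?at A) = card (?at E - ?at R) + card (?at A)"
    using sub fin \<open>finite E\<close> by (intro card_Un_disjoint) auto
  moreover have "card (?at E - ?at R) = card (?at E) - card (?at R)"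
    using sub fin by (intro card_Diff_subset) auto
  moreover have "card (?at R) \<le> card (?at E)"
    using sub \<open>finite E\<close> by (intro card_mono) auto
  ultimately show ?thesis using cards by (simp add: degree_def)
qed

lemma switch_realizations:
  assumes "E \<in> realizations n d" "switchable E u x w s p q"
  shows "switch E u x w s p q \<in> realizations n d"
proof -
  have simple: "simple_graph n E" using assms by (simp add: realizations_def)
  have edges: "{u, x} \<in> E" "{w, s} \<in> E" "{p, q} \<in> E" and "distinct [u, x, w, s, p, q]"
    using assms(2) by (simp_all add: switchable_def)
  then have "{u, w} \<subseteq> {1..n} \<and> card {u, w} = 2" "{x, p} \<subseteq> {1..n} \<and> card {x, p} = 2"
    "{s, q} \<subseteq> {1..n} \<and> card {s, q} = 2"
    using edges[THEN simple_graph_edgeD(1)[OF simple]] edges[THEN simple_graph_edgeD(2)[OF simple]]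
    by simp_all
  then have "simple_graph n (switch E u x w s p q)"
    using simple unfolding simple_graph_def switch_def by blast
  then show ?thesis
    using assms degree_switch[OF assms(2) simple_graph_finite[OF simple]]
    by (simp add: realizations_def)
qed

lemma card_switch_diff_le:
  assumes "finite E"
  shows "card (switch E u x w s p q - G) \<le> card (E - G) + 3"
proof -
  have "card (switch E u x w s p q - G) \<le> card ((E - G) \<union> {{u, w}, {x, p}, {s, q}})"
    using assms by (intro card_mono) (auto simp: switch_def)
  also have "\<dots> \<le> card (E - G) + card {{u, w}, {x, p}, {s, q}}"
    by (rule card_Un_le)
  also have "card {{u, w}, {x, p}, {s, q}} \<le> 3"
    by (simp add: card_insert_if)
  finally show ?thesis by simp
qed

section \<open>Realizations of a sequence with degrees at most \<open>D\<close>\<close>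

locale bounded_degrees =
  fixes n :: nat and d :: "nat \<Rightarrow> nat" and D :: nat
  assumes d_le: "v \<in> {1..n} \<Longrightarrow> d v \<le> D"
begin

abbreviation "\<Omega> \<equiv> realizations n d"
definition "M1 = (\<Sum>i=1..n. d i)"
definition "M2 = (\<Sum>i=1..n. d i * (d i - 1))"

lemma realization_simple: "E \<in> \<Omega> \<Longrightarrow> simple_graph n E"
  by (simp add: realizations_def)

lemma card_nbrs_realization: "E \<in> \<Omega> \<Longrightarrow> v \<in> {1..n} \<Longrightarrow> card (nbrs E v) = d v"
  using card_nbrs[of n E v] by (auto simp: realizations_def)

lemma card_nbrs_le:
  assumes "E \<in> \<Omega>"
  shows "card (nbrs E v) \<le> D"
proof (cases "v \<in> {1..n}")
  case True
  then show ?thesis using assms d_le card_nbrs_realization by simp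
next
  case False
  then have "nbrs E v = {}"
    using simple_graph_edgeD(1)[OF realization_simple[OF assms]] unfolding nbrs_def by blast
  then show ?thesis by simp
qed

lemma arcs_eq_Sigma: "E \<in> \<Omega> \<Longrightarrow> arcs E = Sigma {1..n} (nbrs E)"
  using simple_graph_edgeD(1)[OF realization_simple] unfolding arcs_def nbrs_def by blast

lemma card_arcs:
  assumes "E \<in> \<Omega>"
  shows "card (arcs E) = M1"
  unfolding arcs_eq_Sigma[OF assms] M1_def using assms
  by (subst card_SigmaI)
    (auto intro: finite_nbrs realization_simple simp: card_nbrs_realization)

lemma finite_arcs: "E \<in> \<Omega> \<Longrightarrow> finite (arcs E)"
  using finite_nbrs[OF realization_simple] by (auto simp: arcs_eq_Sigma)

lemma card_arcs_from_le:
  assumes "E \<in> \<Omega>" "finite X"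
  shows "card {(p, q). p \<in> X \<and> {p, q} \<in> E} \<le> card X * D"
    and "card {(p, q). q \<in> X \<and> {p, q} \<in> E} \<le> card X * D"
proof -
  have eq: "{(p, q). p \<in> X \<and> {p, q} \<in> E} = Sigma X (nbrs E)"
    by (auto simp: nbrs_def)
  show le: "card {(p, q). p \<in> X \<and> {p, q} \<in> E} \<le> card X * D"
    unfolding eq using assms finite_nbrs[OF realization_simple] card_nbrs_le
    by (intro card_Sigma_le) auto
  have "{(p, q). q \<in> X \<and> {p, q} \<in> E} = prod.swap ` {(p, q). p \<in> X \<and> {p, q} \<in> E}"
    by (auto simp: image_iff insert_commute)
  then show "card {(p, q). q \<in> X \<and> {p, q} \<in> E} \<le> card X * D"
    using le by (simp add: card_image)
qed

text \<open>An arc \<open>(p, q)\<close> is bad only if \<open>p\<close> is one of the at most 4 + 9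
  listed vertices or a neighbour of \<open>x\<close>, or \<open>q\<close> is a listed vertex or a
  neighbour of \<open>s\<close>. Either case covers at most (13 + D) * D <= 14 * D^2 arcs, so at
  most 28 * D^2 arcs are bad, which is no more than half of \<open>M1\<close>. The list
  \<open>ws\<close> holds vertices that the switching has to avoid.\<close>

lemma card_switchable_ge:
  assumes E: "E \<in> \<Omega>" and dist: "distinct [u, x, w, s]"
    and edges: "{u, x} \<in> E" "{w, s} \<in> E" "{u, w} \<notin> E"
    and len: "length ws \<le> 9" and M: "56 * D\<^sup>2 \<le> M1"
  shows "M1 \<le> 2 * card {(p, q). switchable E u x w s p q \<and> p \<notin> set ws \<and> q \<notin> set ws}"
proof -
  let ?good = "{(p, q). switchable E u x w s p q \<and> p \<notin> set ws \<and> q \<notin> set ws}"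
  let ?W = "set (u # x # w # s # ws)"
  let ?P = "{(p, q). p \<in> ?W \<union> nbrs E x \<and> {p, q} \<in> E}"
  let ?Q = "{(p, q). q \<in> ?W \<union> nbrs E s \<and> {p, q} \<in> E}"
  have W: "card ?W \<le> 13" using card_length[of "u # x # w # s # ws"] len by simp
  have fin: "finite (nbrs E v)" for v using E finite_nbrs realization_simple by blast
  have size: "card (?W \<union> nbrs E v) * D \<le> 14 * D\<^sup>2" for v
  proof -
    have "card (?W \<union> nbrs E v) \<le> 13 + D"
      using card_Un_le[of ?W "nbrs E v"] W card_nbrs_le[OF E, of v] by linarith
    then have "card (?W \<union> nbrs E v) * D \<le> (13 + D) * D" by (rule mult_right_mono) simp
    also have "\<dots> \<le> 14 * D\<^sup>2"
      by (cases D) (auto simp: power2_eq_square algebra_simps)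
    finally show ?thesis .
  qed
  have P: "card ?P \<le> 14 * D\<^sup>2"
    by (rule order_trans[OF card_arcs_from_le(1)[OF E] size]) (use fin in auto)
  have Q: "card ?Q \<le> 14 * D\<^sup>2"
    by (rule order_trans[OF card_arcs_from_le(2)[OF E] size]) (use fin in auto)
  have good_fin: "finite ?good"
    by (rule finite_subset[OF _ finite_arcs[OF E]]) (auto simp: arcs_def switchable_def)
  have PQ_fin: "finite ?P" "finite ?Q"
    by (rule finite_subset[OF _ finite_arcs[OF E]]; auto simp: arcs_def)+
  have "arcs E \<subseteq> ?good \<union> (?P \<union> ?Q)"
  proof
    fix z assume "z \<in> arcs E"
    then obtain p q where z: "z = (p, q)" "{p, q} \<in> E" by (auto simp: arcs_def)
    then have "p \<noteq> q" using simple_graph_edgeD[OF realization_simple[OF E]] by blast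
    show "z \<in> ?good \<union> (?P \<union> ?Q)"
    proof (cases "p \<in> ?W \<union> nbrs E x \<or> q \<in> ?W \<union> nbrs E s")
      case True
      then show ?thesis using z by blast
    next
      case False
      then have "switchable E u x w s p q"
        using \<open>p \<noteq> q\<close> z(2) dist edges unfolding switchable_def nbrs_def by auto
      then show ?thesis using False z by simp
    qed
  qed
  then have "M1 \<le> card (?good \<union> (?P \<union> ?Q))"
    using card_mono[of "?good \<union> (?P \<union> ?Q)" "arcs E"] good_fin PQ_fin card_arcs[OF E] by simp
  also have "\<dots> \<le> card ?good + (card ?P + card ?Q)"
    using card_Un_le[of ?good "?P \<union> ?Q"] card_Un_le[of ?P ?Q] by linarith
  finally show ?thesis using P Q M by linarith
qed

text \<open>\<open>T'\<close> forgets \<open>x\<close> and \<open>s\<close>: for a given \<open>(H, c)\<close> the switching is determined by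
  the two arcs \<open>(x, p)\<close> and \<open>(s, q)\<close> of \<open>H\<close>, so the gain of a factor \<open>M\<^sub>1 / 2\<close> in the choice of
  \<open>(p, q)\<close> stands against a loss of at most \<open>M\<^sub>1\<^sup>2\<close>.\<close>

lemma switching_step:
  fixes T :: "(nat set set \<times> nat \<times> nat \<times> 'c) set" and T' :: "(nat set set \<times> 'c) set"
    and u w :: "'c \<Rightarrow> nat"
  assumes fin: "finite T" "finite T'" and M: "56 * D\<^sup>2 \<le> M1" "0 < M1"
    and T': "\<And>H c. (H, c) \<in> T' \<Longrightarrow> H \<in> \<Omega>"
    and T: "\<And>E x s c. (E, x, s, c) \<in> T \<Longrightarrow> E \<in> \<Omega> \<and> distinct [u c, x, w c, s] \<and>
        {u c, x} \<in> E \<and> {w c, s} \<in> E \<and> {u c, w c} \<notin> E \<and>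
        (\<exists>ws. length ws \<le> 9 \<and> (\<forall>p q. p \<notin> set ws \<longrightarrow> q \<notin> set ws \<longrightarrow>
           switchable E (u c) x (w c) s p q \<longrightarrow> (switch E (u c) x (w c) s p q, c) \<in> T'))"
  shows "card T \<le> 2 * M1 * card T'"
proof -
  define B where "B = (\<lambda>(E, x, s, c). {(p, q). switchable E (u c) x (w c) s p q \<and>
      (switch E (u c) x (w c) s p q, c) \<in> T'})"
  define \<phi> where "\<phi> = (\<lambda>((E, x, s, c), (p, q)).
      ((switch E (u c) x (w c) s p q, c), ((x, p), (s, q))))"
  have B_fin: "finite (B \<tau>)" if "\<tau> \<in> T" for \<tau>
  proof -
    obtain E x s c where \<tau>: "\<tau> = (E, x, s, c)" by (cases \<tau>)
    then have "E \<in> \<Omega>" using that T by blast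
    from finite_arcs[OF this] show ?thesis
      by (rule rev_finite_subset) (auto simp: \<tau> B_def arcs_def switchable_def)
  qed
  have B_card: "M1 \<le> 2 * card (B \<tau>)" if \<tau>T: "\<tau> \<in> T" for \<tau>
  proof -
    obtain E x s c where \<tau>: "\<tau> = (E, x, s, c)" by (cases \<tau>)
    with \<tau>T T[of E x s c] obtain ws where ws: "length ws \<le> 9"
      "\<And>p q. p \<notin> set ws \<Longrightarrow> q \<notin> set ws \<Longrightarrow> switchable E (u c) x (w c) s p q \<Longrightarrow>
        (switch E (u c) x (w c) s p q, c) \<in> T'"
      and E: "E \<in> \<Omega>" "distinct [u c, x, w c, s]" "{u c, x} \<in> E" "{w c, s} \<in> E" "{u c, w c} \<notin> E"
      by blast
    have "M1 \<le> 2 * card {(p, q). switchable E (u c) x (w c) s p q \<and> p \<notin> set ws \<and> q \<notin> set ws}"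
      using card_switchable_ge[OF E ws(1) M(1)] .
    also have "card {(p, q). switchable E (u c) x (w c) s p q \<and> p \<notin> set ws \<and> q \<notin> set ws}
        \<le> card (B \<tau>)"
      using B_fin[OF \<tau>T] ws(2) by (intro card_mono) (auto simp: B_def \<tau>)
    finally show ?thesis by simp
  qed
  \<comment> \<open>The label \<open>c\<close> determines \<open>u\<close> and \<open>w\<close>, and
    the two recorded arcs determine \<open>x\<close>, \<open>p\<close>, \<open>s\<close>,
    \<open>q\<close>. With all six vertices known, the inverse switching recovers
    \<open>E\<close>.\<close>
  have inj: "inj_on \<phi> (Sigma T B)"
  proof (rule inj_onI)
    fix z z' assume z: "z \<in> Sigma T B" "z' \<in> Sigma T B" and eq: "\<phi> z = \<phi> z'"
    obtain E x s c p q where z1: "z = ((E, x, s, c), (p, q))" by (cases z) auto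
    obtain E' x' s' c' p' q' where z2: "z' = ((E', x', s', c'), (p', q'))" by (cases z') auto
    have same: "x' = x" "s' = s" "c' = c" "p' = p" "q' = q"
      and H: "switch E (u c) x (w c) s p q = switch E' (u c) x (w c) s p q"
      using eq by (auto simp: \<phi>_def z1 z2)
    have "switchable E (u c) x (w c) s p q" "switchable E' (u c) x (w c) s p q"
      using z by (auto simp: z1 z2 same B_def)
    then have "E = E'" using switch_inverse H by metis
    then show "z = z'" by (simp add: z1 z2 same)
  qed
  let ?C = "Sigma T' (\<lambda>(H, c). arcs H \<times> arcs H)"
  have image: "\<phi> ` Sigma T B \<subseteq> ?C"
    by (auto simp: \<phi>_def B_def arcs_def switch_def)
  have C_fin: "finite ?C" using fin T' finite_arcs by auto
  have "card T * M1 \<le> 2 * card (Sigma T B)"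
  proof -
    have "card T * M1 = (\<Sum>\<tau>\<in>T. M1)" by simp
    also have "\<dots> \<le> (\<Sum>\<tau>\<in>T. 2 * card (B \<tau>))" using B_card by (intro sum_mono)
    finally show ?thesis using fin B_fin by (simp add: card_SigmaI sum_distrib_left)
  qed
  also have "card (Sigma T B) \<le> card ?C" by (rule card_inj_on_le[OF inj image C_fin])
  also have "card ?C \<le> card T' * (M1 * M1)"
    using fin T' finite_arcs card_arcs
    by (intro card_Sigma_le) (auto simp: card_cartesian_product)
  finally have "card T * M1 \<le> (2 * M1 * card T') * M1" by (simp add: algebra_simps)
  then show ?thesis using M(2) by simp
qed

text \<open>Only edges gained over some \<open>G\<close> in \<open>N\<close> are counted: a
  configuration that \<open>G\<close> lacks but \<open>E\<close> has must use an edge of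
  \<open>E - G\<close>, so few such edges mean few configurations.\<close>

definition near :: "nat set set set \<Rightarrow> nat \<Rightarrow> nat set set set" where
  "near N k = {E \<in> \<Omega>. \<exists>G\<in>N. card (E - G) \<le> k}"

text \<open>\<open>F\<close> and \<open>K\<close> are the edges and non-edges on which the remaining switchings rely.\<close>

definition config :: "nat set set set \<Rightarrow> nat \<Rightarrow> nat set set \<Rightarrow> nat list \<Rightarrow> nat set set \<Rightarrow> nat set set \<Rightarrow> bool" where
  "config N k E vs F K \<longleftrightarrow> E \<in> near N k \<and> distinct vs \<and> set vs \<subseteq> {1..n} \<and> F \<subseteq> E \<and> K \<inter> E = {}"

lemma near_switch:
  assumes "E \<in> near N k" "switchable E u x w s p q"
  shows "switch E u x w s p q \<in> near N (k + 3)"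
proof -
  from assms(1) obtain G where G: "E \<in> \<Omega>" "G \<in> N" "card (E - G) \<le> k"
    unfolding near_def by blast
  have "card (switch E u x w s p q - G) \<le> card (E - G) + 3"
    by (rule card_switch_diff_le) (rule simple_graph_finite[OF realization_simple[OF G(1)]])
  with G(3) have "card (switch E u x w s p q - G) \<le> k + 3" by linarith
  then show ?thesis
    using G(2) switch_realizations[OF G(1) assms(2)] unfolding near_def by blast
qed

text \<open>All edges in \<open>F\<close> and non-edges in \<open>K\<close> live on
  \<open>vs\<close>, while \<open>p\<close> and \<open>q\<close> lie outside. Hence removing
  \<open>pq\<close> and adding \<open>xp\<close>, \<open>sq\<close> cannot disturb \<open>F\<close>
  or \<open>K\<close>; within \<open>vs\<close> the switching only trades \<open>ux\<close>,
  \<open>ws\<close> for \<open>uw\<close>.\<close>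

lemma config_switch:
  assumes "config N k E vs F K" "switchable E u x w s p q" "p \<notin> set vs" "q \<notin> set vs"
    and "\<Union>F \<subseteq> set vs" "\<Union>K \<subseteq> set vs" "distinct vs'" "set vs' \<subseteq> set vs"
    and F': "F' \<subseteq> insert {u, w} (F - {{u, x}, {w, s}})" and K': "K' \<subseteq> K - {{u, w}}"
  shows "config N (k + 3) (switch E u x w s p q) vs' F' K'"
proof -
  have c: "E \<in> near N k" "set vs \<subseteq> {1..n}" "F \<subseteq> E" "K \<inter> E = {}"
    using assms(1) by (simp_all add: config_def)
  have "{p, q} \<notin> F" "{x, p} \<notin> K" "{s, q} \<notin> K" using assms(3-6) by blast+
  then have "F' \<subseteq> switch E u x w s p q" "K' \<inter> switch E u x w s p q = {}"
    using F' K' c(3,4) unfolding switch_def by blast+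
  then show ?thesis
    using near_switch[OF c(1) assms(2)] assms(7,8) c(2) unfolding config_def by blast
qed

text \<open>This specializes \<open>switching_step\<close> to configurations, so that each switching
  of the main argument is reduced to a finite check on vertex lists. The vertices \<open>x\<close>
  and \<open>s\<close> are separate from \<open>c\<close> because the switching forgets them, and
  \<open>R\<close> carries the degree conditions, which no switching changes.\<close>

lemma config_step:
  fixes u w :: "'c \<Rightarrow> nat" and vs' :: "'c \<Rightarrow> nat list" and F' K' :: "'c \<Rightarrow> nat set set"
  assumes M: "56 * D\<^sup>2 \<le> M1" "0 < M1"
    and fin: "finite {(E, x, s, c). config N k E (vs x s c) (F x s c) (K x s c) \<and> R c}"
      "finite {(E, c). config N (k + 3) E (vs' c) (F' c) (K' c) \<and> R c}"
    and step: "\<And>x s c. distinct (vs x s c) \<Longrightarrow>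
      length (vs x s c) \<le> 9 \<and> distinct [u c, x, w c, s] \<and>
      {u c, x} \<in> F x s c \<and> {w c, s} \<in> F x s c \<and> {u c, w c} \<in> K x s c \<and>
      \<Union>(F x s c) \<subseteq> set (vs x s c) \<and> \<Union>(K x s c) \<subseteq> set (vs x s c) \<and>
      distinct (vs' c) \<and> set (vs' c) \<subseteq> set (vs x s c) \<and>
      F' c \<subseteq> insert {u c, w c} (F x s c - {{u c, x}, {w c, s}}) \<and>
      K' c \<subseteq> K x s c - {{u c, w c}}"
  shows "card {(E, x, s, c). config N k E (vs x s c) (F x s c) (K x s c) \<and> R c}
    \<le> 2 * M1 * card {(E, c). config N (k + 3) E (vs' c) (F' c) (K' c) \<and> R c}"
proof (rule switching_step[OF fin M])
  fix H c assume "(H, c) \<in> {(E, c). config N (k + 3) E (vs' c) (F' c) (K' c) \<and> R c}"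
  then show "H \<in> \<Omega>" by (simp add: config_def near_def)
next
  fix E x s c
  assume "(E, x, s, c) \<in> {(E, x, s, c). config N k E (vs x s c) (F x s c) (K x s c) \<and> R c}"
  then have conf: "config N k E (vs x s c) (F x s c) (K x s c)" and R: "R c" by simp_all
  then have E: "E \<in> \<Omega>" and dist: "distinct (vs x s c)"
    and FK: "F x s c \<subseteq> E" "K x s c \<inter> E = {}"
    by (simp_all add: config_def near_def)
  note st = step[OF dist]
  show "E \<in> \<Omega> \<and> distinct [u c, x, w c, s] \<and>
      {u c, x} \<in> E \<and> {w c, s} \<in> E \<and> {u c, w c} \<notin> E \<and>
      (\<exists>ws. length ws \<le> 9 \<and> (\<forall>p q. p \<notin> set ws \<longrightarrow> q \<notin> set ws \<longrightarrow>
         switchable E (u c) x (w c) s p q \<longrightarrow> (switch E (u c) x (w c) s p q, c)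
           \<in> {(E, c). config N (k + 3) E (vs' c) (F' c) (K' c) \<and> R c}))"
  proof (intro conjI exI[of _ "vs x s c"] allI impI)
    fix p q assume "p \<notin> set (vs x s c)" "q \<notin> set (vs x s c)" "switchable E (u c) x (w c) s p q"
    then have "config N (k + 3) (switch E (u c) x (w c) s p q) (vs' c) (F' c) (K' c)"
      using st by (intro config_switch[OF conf]) blast+
    with R show "(switch E (u c) x (w c) s p q, c)
      \<in> {(E, c). config N (k + 3) E (vs' c) (F' c) (K' c) \<and> R c}" by simp
  qed (use E st FK in blast)+
qed

section \<open>Placing the two vertices\<close>

definition far :: "nat set set \<Rightarrow> nat set \<Rightarrow> nat \<Rightarrow> bool" where
  "far E W a \<longleftrightarrow> a \<notin> W \<and> (\<forall>z\<in>W. {z, a} \<notin> E)"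

text \<open>At most 6 vertices of \<open>L\<close> lie in \<open>W\<close> and at most 6 * K are
  adjacent to it. Together these are at most half of \<open>L\<close>.\<close>

lemma card_far_ge:
  assumes "finite W" "card W \<le> 6" "finite L"
    and K: "\<And>z. card {a \<in> L. {z, a} \<in> E} \<le> K" and "12 * (1 + K) \<le> card L"
  shows "card L \<le> 2 * card {a \<in> L. far E W a}"
proof -
  define bad where "bad = (\<Union>z\<in>W. {a \<in> L. {z, a} \<in> E})"
  have "card bad \<le> (\<Sum>z\<in>W. card {a \<in> L. {z, a} \<in> E})"
    unfolding bad_def using assms(1) by (rule card_UN_le)
  also have "\<dots> \<le> (\<Sum>z\<in>W. K)" using K by (intro sum_mono)
  also have "\<dots> \<le> 6 * K" using assms(2) by simp
  finally have bad: "card bad \<le> 6 * K" .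
  have "card L \<le> card ({a \<in> L. far E W a} \<union> (W \<union> bad))"
    using assms(1,3) by (intro card_mono) (auto simp: far_def bad_def)
  also have "\<dots> \<le> card {a \<in> L. far E W a} + (card W + card bad)"
    using card_Un_le[of "{a \<in> L. far E W a}" "W \<union> bad"] card_Un_le[of W bad] by linarith
  finally have "card L \<le> card {a \<in> L. far E W a} + (6 + 6 * K)"
    using bad assms(2) by linarith
  moreover have "12 + 12 * K \<le> card L" using assms(5) by simp
  ultimately show ?thesis by linarith
qed

definition cherries :: "nat set set \<Rightarrow> (nat \<times> nat \<times> nat) set" where
  "cherries E = {(v, x, y). {v, x} \<in> E \<and> {v, y} \<in> E \<and> x \<noteq> y}"

lemma cherries_eq_Sigma:
  assumes "E \<in> \<Omega>"
  shows "cherries E = (SIGMA v:{1..n}. SIGMA x:nbrs E v. nbrs E v - {x})"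
  using simple_graph_edgeD(1)[OF realization_simple[OF assms]]
  unfolding cherries_def nbrs_def by blast

lemma finite_cherries: "E \<in> \<Omega> \<Longrightarrow> finite (cherries E)"
  by (simp add: cherries_eq_Sigma finite_nbrs[OF realization_simple])

text \<open>Choose the centre \<open>v\<close>, then an ordered pair of distinct neighbours.\<close>

lemma card_cherries:
  assumes "E \<in> \<Omega>"
  shows "card (cherries E) = M2"
proof -
  have fin: "finite (nbrs E v)" for v using finite_nbrs[OF realization_simple[OF assms]] .
  have "card (SIGMA x:nbrs E v. nbrs E v - {x}) = d v * (d v - 1)" if "v \<in> {1..n}" for v
    using fin that card_nbrs_realization[OF assms that] by (simp add: card_SigmaI)
  then show ?thesis
    unfolding cherries_eq_Sigma[OF assms] M2_def using fin by (subst card_SigmaI) auto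
qed

text \<open>The two conditions \<open>far\<close> serve to make all vertices of the initial
  configuration distinct: as \<open>a\<close> is not adjacent to \<open>v\<close>, \<open>x\<close>,
  \<open>y\<close>, its neighbours differ from these, and as \<open>b\<close> is also far from
  \<open>a\<close> and the neighbours of \<open>a\<close>, the neighbours of \<open>b\<close> are
  new again. They also make \<open>va\<close>, \<open>vb\<close>, \<open>ab\<close>
  non-edges.\<close>

definition placements :: "nat set \<Rightarrow> nat set set \<Rightarrow> ((nat \<times> nat \<times> nat) \<times> nat \<times> nat) set" where
  "placements L E = {((v, x, y), a, b). (v, x, y) \<in> cherries E \<and> a \<in> L \<and> b \<in> L \<and>
     far E {v, x, y} a \<and> far E ({v, x, y, a} \<union> nbrs E a) b}"

lemma card_placements_ge:
  assumes E: "E \<in> \<Omega>" and L: "finite L" "\<And>a. a \<in> L \<Longrightarrow> card (nbrs E a) \<le> 2"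
    and K: "\<And>z. card {a \<in> L. {z, a} \<in> E} \<le> K" "12 * (1 + K) \<le> card L"
  shows "M2 * (card L)\<^sup>2 \<le> 4 * card (placements L E)" and "finite (placements L E)"
proof -
  define A where "A = (\<lambda>(v, x, y). {a \<in> L. far E {v, x, y} a})"
  define B where "B = (\<lambda>(v, x, y) a. {b \<in> L. far E ({v, x, y, a} \<union> nbrs E a) b})"
  have eq: "placements L E = (SIGMA c:cherries E. SIGMA a:A c. B c a)"
    by (auto simp: placements_def A_def B_def)
  have fin: "finite (A c)" "finite (B c a)" for c a
    using L(1) by (auto simp: A_def B_def split: prod.splits)
  then show "finite (placements L E)" using finite_cherries[OF E] by (simp add: eq)
  have A: "card L \<le> 2 * card (A c)" for c
  proof -
    obtain v x y where c: "c = (v, x, y)" by (cases c)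
    have "card {v, x, y} \<le> 6" by (simp add: card_insert_if)
    then show ?thesis using card_far_ge[OF _ _ L(1) K] by (simp add: c A_def)
  qed
  have B: "card L \<le> 2 * card (B c a)" if "a \<in> A c" for c a
  proof -
    obtain v x y where c: "c = (v, x, y)" by (cases c)
    have "a \<in> L" using that by (simp add: A_def c)
    have "card ({v, x, y, a} \<union> nbrs E a) \<le> card {v, x, y, a} + card (nbrs E a)"
      by (rule card_Un_le)
    \<comment> \<open>Four named vertices and at most two neighbours of \<open>a\<close>: this is
      the size 6 that \<open>card_far_ge\<close> allows.\<close>
    also have "\<dots> \<le> 4 + 2"
      using L(2)[OF \<open>a \<in> L\<close>] by (intro add_mono) (simp_all add: card_insert_if)
    finally have "card ({v, x, y, a} \<union> nbrs E a) \<le> 6" by simp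
    moreover have "finite ({v, x, y, a} \<union> nbrs E a)"
      using finite_nbrs[OF realization_simple[OF E]] by simp
    ultimately show ?thesis using card_far_ge[OF _ _ L(1) K] unfolding c B_def prod.case by blast
  qed
  \<comment> \<open>Half of \<open>card L\<close> is rounded up to an integer \<open>h\<close>; then
    both choices have at least \<open>h\<close> options, and the square of \<open>card L\<close> is
    at most 4 * h^2.\<close>
  have half: "(card L + 1) div 2 \<le> card (A c)" "a \<in> A c \<Longrightarrow> (card L + 1) div 2 \<le> card (B c a)" for c a
    using A[of c] B[of a c] by linarith+
  let ?h = "(card L + 1) div 2"
  have "?h * ?h \<le> card (SIGMA a:A c. B c a)" for c
  proof -
    have "?h * ?h \<le> card (A c) * ?h" using half(1) by (rule mult_right_mono) simp
    also have "\<dots> \<le> card (SIGMA a:A c. B c a)" using fin half(2) by (intro card_Sigma_ge) auto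
    finally show ?thesis .
  qed
  then have "card (cherries E) * (?h * ?h) \<le> card (placements L E)"
    unfolding eq using fin finite_cherries[OF E] by (intro card_Sigma_ge) auto
  moreover have "(card L)\<^sup>2 \<le> 4 * (?h * ?h)"
  proof -
    have "card L \<le> 2 * ?h" by linarith
    then have "card L * card L \<le> (2 * ?h) * (2 * ?h)" by (intro mult_mono) simp_all
    then show ?thesis by (simp add: power2_eq_square)
  qed
  then have "M2 * (card L)\<^sup>2 \<le> M2 * (4 * (?h * ?h))" by (rule mult_left_mono) simp
  ultimately show "M2 * (card L)\<^sup>2 \<le> 4 * card (placements L E)"
    unfolding card_cherries[OF E] by linarith
qed

section \<open>Configurations forcing a symmetry\<close>

definition leaf_pairs :: "nat set set \<Rightarrow> (nat \<times> nat \<times> nat) set" where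
  "leaf_pairs E = {(v, a, b). distinct [v, a, b] \<and> {v, a, b} \<subseteq> {1..n} \<and>
     {{v, a}, {v, b}} \<subseteq> E \<and> d a = 1 \<and> d b = 1}"

definition ears :: "nat set set \<Rightarrow> (nat \<times> nat \<times> nat) set" where
  "ears E = {(v, a, b). distinct [v, a, b] \<and> {v, a, b} \<subseteq> {1..n} \<and>
     {{v, a}, {v, b}, {a, b}} \<subseteq> E \<and> d a = 2 \<and> d b = 2}"

lemma card_Union_edges_le:
  assumes "\<And>e. e \<in> F \<Longrightarrow> card e = 2"
  shows "card (\<Union>F) \<le> 2 * card F"
  using card_Union_le_sum_card[of F] assms by simp

text \<open>\<open>V\<close> collects the endpoints of the at most \<open>k\<close> edges of
  \<open>E\<close> missing from \<open>G\<close>. A configuration absent from \<open>G\<close> has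
  an edge inside \<open>V\<close>.\<close>

lemma new_vertices:
  assumes "E \<in> near N k"
  obtains G V where "G \<in> N" "finite V" "card V \<le> 2 * k" "\<And>e. e \<in> E \<Longrightarrow> e \<notin> G \<Longrightarrow> e \<subseteq> V"
proof -
  from assms obtain G where G: "E \<in> \<Omega>" "G \<in> N" "card (E - G) \<le> k"
    unfolding near_def by blast
  have edges: "e \<subseteq> {1..n} \<and> card e = 2" if "e \<in> E" for e
    using realization_simple[OF G(1)] that unfolding simple_graph_def by blast
  show thesis
  proof (rule that[OF G(2), of "\<Union>(E - G)"])
    show "finite (\<Union>(E - G))"
      by (rule finite_subset[of _ "{1..n}"]) (use edges in blast)+
    have "card (\<Union>(E - G)) \<le> 2 * card (E - G)"
      using edges by (intro card_Union_edges_le) blast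
    then show "card (\<Union>(E - G)) \<le> 2 * k" using G(3) by linarith
  qed blast
qed

lemma card_leaf_nbrs_le:
  assumes G: "G \<in> \<Omega>" and no_pair: "leaf_pairs G = {}"
  shows "card {b \<in> nbrs G v. d b = 1} \<le> 1"
proof -
  have "b = b'" if "b \<in> {b \<in> nbrs G v. d b = 1}" "b' \<in> {b \<in> nbrs G v. d b = 1}" for b b'
  proof (rule ccontr)
    assume "b \<noteq> b'"
    have e: "{v, b} \<in> G" "{v, b'} \<in> G" "d b = 1" "d b' = 1"
      using that by (simp_all add: nbrs_def)
    note ed = simple_graph_edgeD[OF realization_simple[OF G]]
    have "(v, b, b') \<in> leaf_pairs G"
      using e ed[OF e(1)] ed[OF e(2)] \<open>b \<noteq> b'\<close> by (simp add: leaf_pairs_def)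
    with no_pair show False by simp
  qed
  then show ?thesis
    using finite_nbrs[OF realization_simple[OF G], of v] by (simp add: card_le_Suc0_iff_eq)
qed

text \<open>One of the two edges is new, say \<open>va\<close>. Then \<open>a\<close> is one of at
  most 12 vertices of \<open>V\<close>, and \<open>v\<close> is its only neighbour. The leaf
  \<open>b\<close> lies in \<open>V\<close> if \<open>vb\<close> is new and otherwise is the at most
  one leaf next to \<open>v\<close> in \<open>G\<close>, which leaves 13 choices. The other case is
  symmetric: 2 * 12 * 13 = 312.\<close>

lemma card_leaf_pairs_le:
  assumes E: "E \<in> near N 6" and N: "\<And>G. G \<in> N \<Longrightarrow> leaf_pairs G = {}" "N \<subseteq> \<Omega>"
  shows "card (leaf_pairs E) \<le> 312"
proof -
  obtain G V where GV: "G \<in> N" "finite V" "card V \<le> 2 * 6"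
    and V: "\<And>e. e \<in> E \<Longrightarrow> e \<notin> G \<Longrightarrow> e \<subseteq> V" by (rule new_vertices[OF E]) blast
  have E\<Omega>: "E \<in> \<Omega>" and G\<Omega>: "G \<in> \<Omega>" using E GV(1) N(2) unfolding near_def by blast+
  define V1 where "V1 = {a \<in> V. a \<in> {1..n} \<and> d a = 1}"
  define B where "B = (\<lambda>v. V \<union> {b \<in> nbrs G v. d b = 1})"
  define Z where "Z = (SIGMA a:V1. SIGMA v:nbrs E a. B v)"
  have fin: "finite V1" "finite (nbrs E a)" "finite (nbrs G a)" "finite (B a)" for a
    using GV(2) finite_nbrs[OF realization_simple[OF E\<Omega>]] finite_nbrs[OF realization_simple[OF G\<Omega>]]
    by (simp_all add: V1_def B_def)
  note one = card_leaf_nbrs_le[OF G\<Omega> N(1)[OF GV(1)]]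
  have B: "card (B v) \<le> 13" for v
    unfolding B_def using card_Un_le[of V "{b \<in> nbrs G v. d b = 1}"] GV(3) one[of v]
    by linarith
  have inner: "card (SIGMA v:nbrs E a. B v) \<le> 13" if "a \<in> V1" for a
  proof -
    have "card (SIGMA v:nbrs E a. B v) \<le> card (nbrs E a) * 13"
      using fin B by (intro card_Sigma_le) auto
    also have "card (nbrs E a) = 1"
      using that card_nbrs_realization[OF E\<Omega>, of a] by (simp add: V1_def)
    finally show ?thesis by simp
  qed
  have "card Z \<le> card V1 * 13"
    unfolding Z_def using fin inner by (intro card_Sigma_le) auto
  moreover have "card V1 \<le> card V"
    unfolding V1_def using GV(2) by (intro card_mono) auto
  ultimately have Z: "card Z \<le> 156" using GV(3) by linarith
  have Z_fin: "finite Z" using fin by (simp add: Z_def)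
  have aux: "(a, v, b) \<in> Z" if "(v, a, b) \<in> leaf_pairs E" "{v, a} \<notin> G" for v a b
  proof -
    have h: "{v, a} \<in> E" "{v, b} \<in> E" "d a = 1" "d b = 1" "a \<in> {1..n}"
      using that by (simp_all add: leaf_pairs_def)
    have "a \<in> V1" using V[OF h(1) that(2)] h by (simp add: V1_def)
    moreover have "v \<in> nbrs E a" using h(1) by (simp add: nbrs_def insert_commute)
    moreover have "b \<in> B v"
      using V[OF h(2)] h(4) unfolding B_def nbrs_def by blast
    ultimately show ?thesis by (simp add: Z_def)
  qed
  have "leaf_pairs E \<subseteq> (\<lambda>(a, v, b). (v, a, b)) ` Z \<union> (\<lambda>(a, v, b). (v, b, a)) ` Z"
  proof
    fix t assume t: "t \<in> leaf_pairs E"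
    obtain v a b where vab: "t = (v, a, b)" by (cases t)
    have "(v, a, b) \<notin> leaf_pairs G" using N(1)[OF GV(1)] by simp
    then have "{v, a} \<notin> G \<or> {v, b} \<notin> G" using t unfolding vab leaf_pairs_def by simp blast
    moreover have "(v, b, a) \<in> leaf_pairs E" using t by (simp add: vab leaf_pairs_def)
    ultimately have "(a, v, b) \<in> Z \<or> (b, v, a) \<in> Z" using aux t unfolding vab by blast
    then show "t \<in> (\<lambda>(a, v, b). (v, a, b)) ` Z \<union> (\<lambda>(a, v, b). (v, b, a)) ` Z"
      using imageI[of "(a, v, b)" Z "\<lambda>(a, v, b). (v, a, b)"]
        imageI[of "(b, v, a)" Z "\<lambda>(a, v, b). (v, b, a)"]
      unfolding vab prod.case by blast
  qed
  then have "card (leaf_pairs E) \<le> card ((\<lambda>(a, v, b). (v, a, b)) ` Z \<union> (\<lambda>(a, v, b). (v, b, a)) ` Z)"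
    using Z_fin by (intro card_mono) auto
  also have "\<dots> \<le> card Z + card Z"
    by (rule order_trans[OF card_Un_le]) (intro add_mono card_image_le Z_fin)
  finally show ?thesis using Z by linarith
qed

text \<open>Every edge of the triangle contains \<open>a\<close> or \<open>b\<close>, so a new edge
  puts one of them into \<open>V\<close>, which has at most 18 vertices. If it is \<open>a\<close>,
  then \<open>v\<close> and \<open>b\<close> are among its two neighbours, giving 4 choices; in
  total 2 * 18 * 4 = 144.\<close>

lemma card_ears_le:
  assumes E: "E \<in> near N 9" and N: "\<And>G. G \<in> N \<Longrightarrow> ears G = {}"
  shows "card (ears E) \<le> 144"
proof -
  obtain G V where GV: "G \<in> N" "finite V" "card V \<le> 2 * 9"
    and V: "\<And>e. e \<in> E \<Longrightarrow> e \<notin> G \<Longrightarrow> e \<subseteq> V" by (rule new_vertices[OF E]) blast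
  have E\<Omega>: "E \<in> \<Omega>" using E unfolding near_def by blast
  define V2 where "V2 = {a \<in> V. a \<in> {1..n} \<and> d a = 2}"
  define Z where "Z = (SIGMA a:V2. nbrs E a \<times> nbrs E a)"
  have fin: "finite V2" "finite (nbrs E a)" for a
    using GV(2) finite_nbrs[OF realization_simple[OF E\<Omega>]] by (simp_all add: V2_def)
  have inner: "card (nbrs E a \<times> nbrs E a) \<le> 4" if "a \<in> V2" for a
    using that card_nbrs_realization[OF E\<Omega>, of a] by (simp add: V2_def card_cartesian_product)
  have "card Z \<le> card V2 * 4"
    unfolding Z_def using fin inner by (intro card_Sigma_le) auto
  moreover have "card V2 \<le> card V"
    unfolding V2_def using GV(2) by (intro card_mono) auto
  ultimately have Z: "card Z \<le> 72" using GV(3) by linarith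
  have Z_fin: "finite Z" using fin by (simp add: Z_def)
  have aux: "(a, v, b) \<in> Z" if "(v, a, b) \<in> ears E" "a \<in> V" for v a b
    using that by (simp add: ears_def Z_def V2_def nbrs_def insert_commute)
  have "ears E \<subseteq> (\<lambda>(a, v, b). (v, a, b)) ` Z \<union> (\<lambda>(a, v, b). (v, b, a)) ` Z"
  proof
    fix t assume t: "t \<in> ears E"
    obtain v a b where vab: "t = (v, a, b)" by (cases t)
    have edges: "{v, a} \<in> E" "{v, b} \<in> E" "{a, b} \<in> E" using t by (simp_all add: vab ears_def)
    have "(v, a, b) \<notin> ears G" using N[OF GV(1)] by simp
    then have "{v, a} \<notin> G \<or> {v, b} \<notin> G \<or> {a, b} \<notin> G" using t unfolding vab ears_def by simp blast
    then have "a \<in> V \<or> b \<in> V" using V[OF edges(1)] V[OF edges(2)] V[OF edges(3)] by blast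
    moreover have "(v, b, a) \<in> ears E" using t by (simp add: vab ears_def insert_commute)
    ultimately have "(a, v, b) \<in> Z \<or> (b, v, a) \<in> Z" using aux t unfolding vab by blast
    then show "t \<in> (\<lambda>(a, v, b). (v, a, b)) ` Z \<union> (\<lambda>(a, v, b). (v, b, a)) ` Z"
      using imageI[of "(a, v, b)" Z "\<lambda>(a, v, b). (v, a, b)"]
        imageI[of "(b, v, a)" Z "\<lambda>(a, v, b). (v, b, a)"]
      unfolding vab prod.case by blast
  qed
  then have "card (ears E) \<le> card ((\<lambda>(a, v, b). (v, a, b)) ` Z \<union> (\<lambda>(a, v, b). (v, b, a)) ` Z)"
    using Z_fin by (intro card_mono) auto
  also have "\<dots> \<le> card Z + card Z"
    by (rule order_trans[OF card_Un_le]) (intro add_mono card_image_le Z_fin)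
  finally show ?thesis using Z by linarith
qed

text \<open>Vertices \<open>a\<close> and \<open>b\<close> with the same neighbours apart from each
  other can be transposed: the pair \<open>ab\<close> is mapped to itself, and any other pair
  meeting it is mapped to one with the same adjacency.\<close>

lemma symmetric_graph_swap:
  assumes E: "simple_graph n E" and ab: "a \<in> {1..n}" "b \<in> {1..n}" "a \<noteq> b"
    and twins: "\<And>z. z \<noteq> a \<Longrightarrow> z \<noteq> b \<Longrightarrow> {z, a} \<in> E \<longleftrightarrow> {z, b} \<in> E"
  shows "symmetric_graph n E"
  unfolding symmetric_graph_def graph_automorphism_def
proof (intro exI conjI ballI)
  show "Transposition.transpose a b permutes {1..n}" using ab by (intro permutes_swap_id)
  show "Transposition.transpose a b \<noteq> id" using ab(3) by (metis id_apply transpose_apply_first)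
  fix u v
  show "{u, v} \<in> E \<longleftrightarrow> {Transposition.transpose a b u, Transposition.transpose a b v} \<in> E"
  proof (cases "u = v")
    case True
    then show ?thesis using simple_graph_edgeD(3)[OF E] by blast
  next
    case False
    then consider "u \<notin> {a, b}" "v \<notin> {a, b}" | "u = a" "v = b" | "u = b" "v = a"
      | "u = a" "v \<notin> {a, b}" | "u = b" "v \<notin> {a, b}"
      | "v = a" "u \<notin> {a, b}" | "v = b" "u \<notin> {a, b}" by blast
    then show ?thesis
      by cases (use twins[of u] twins[of v] in \<open>simp_all add: insert_commute\<close>)
  qed
qed

lemma symmetric_if_leaf_pair:
  assumes E: "E \<in> \<Omega>" and "leaf_pairs E \<noteq> {}"
  shows "symmetric_graph n E"
proof -
  obtain v a b where h: "(v, a, b) \<in> leaf_pairs E" using assms(2) by auto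
  have "nbrs E c = {v}" if c: "c \<in> {1..n}" "d c = 1" "{v, c} \<in> E" for c
  proof -
    have "card (nbrs E c) = 1" using card_nbrs_realization[OF E] c by simp
    moreover have "v \<in> nbrs E c" using c by (simp add: nbrs_def insert_commute)
    ultimately show ?thesis by (auto simp: card_1_singleton_iff)
  qed
  then have "nbrs E a = {v}" "nbrs E b = {v}" using h by (simp_all add: leaf_pairs_def)
  then have "{z, a} \<in> E \<longleftrightarrow> {z, b} \<in> E" for z
    unfolding nbrs_iff[symmetric] by simp
  then show ?thesis
    using h by (intro symmetric_graph_swap[OF realization_simple[OF E], of a b])
      (simp_all add: leaf_pairs_def)
qed

text \<open>Degree 2 leaves room for no further edges, so the neighbourhoods of \<open>a\<close> and
  \<open>b\<close> are exactly \<open>{v, b}\<close> and \<open>{v, a}\<close>.\<close>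

lemma symmetric_if_ear:
  assumes E: "E \<in> \<Omega>" and "ears E \<noteq> {}"
  shows "symmetric_graph n E"
proof -
  obtain v a b where h: "(v, a, b) \<in> ears E" using assms(2) by auto
  have nb: "nbrs E c = {v, w}"
    if c: "c \<in> {1..n}" "d c = 2" "{v, c} \<in> E" "{w, c} \<in> E" "v \<noteq> w" for c w
  proof -
    have "card (nbrs E c) = 2" using card_nbrs_realization[OF E] c by simp
    moreover have "{v, w} \<subseteq> nbrs E c" using c by (simp add: nbrs_def insert_commute)
    ultimately show ?thesis
      using c(5) finite_nbrs[OF realization_simple[OF E]] card_seteq[of "nbrs E c" "{v, w}"]
      by simp
  qed
  have "{v, a} \<in> E" "{v, b} \<in> E" "{a, b} \<in> E" "{b, a} \<in> E" "v \<noteq> a" "v \<noteq> b"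
    "a \<in> {1..n}" "b \<in> {1..n}" "d a = 2" "d b = 2"
    using h by (simp_all add: ears_def insert_commute)
  then have "nbrs E a = {v, b}" "nbrs E b = {v, a}"
    using nb[of a b] nb[of b a] by simp_all
  then have "{z, a} \<in> E \<longleftrightarrow> {z, b} \<in> E" if "z \<noteq> a" "z \<noteq> b" for z
    using that unfolding nbrs_iff[symmetric] by simp
  then show ?thesis
    using h by (intro symmetric_graph_swap[OF realization_simple[OF E], of a b])
      (simp_all add: ears_def)
qed

section \<open>Double counting\<close>

lemma card_Sigma_placements_ge:
  assumes N: "N \<subseteq> \<Omega>" and L: "finite L" "\<And>E a. E \<in> N \<Longrightarrow> a \<in> L \<Longrightarrow> card (nbrs E a) \<le> 2"
    and K: "\<And>E z. E \<in> N \<Longrightarrow> card {a \<in> L. {z, a} \<in> E} \<le> K" "12 * (1 + K) \<le> card L"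
  shows "card N * (M2 * (card L)\<^sup>2) \<le> 4 * card (Sigma N (placements L))"
proof -
  have pl: "M2 * (card L)\<^sup>2 \<le> 4 * card (placements L E)" "finite (placements L E)" if "E \<in> N" for E
    using card_placements_ge[OF _ L(1) L(2)[OF that] K(1)[OF that] K(2)] N that by blast+
  have "finite N" using N finite_realizations finite_subset by blast
  have "card N * (M2 * (card L)\<^sup>2) = (\<Sum>E\<in>N. M2 * (card L)\<^sup>2)" by simp
  also have "\<dots> \<le> (\<Sum>E\<in>N. 4 * card (placements L E))" using pl(1) by (intro sum_mono)
  also have "\<dots> = 4 * card (Sigma N (placements L))"
    using pl(2) \<open>finite N\<close> by (simp add: card_SigmaI sum_distrib_left)
  finally show ?thesis .
qed

text \<open>The first switching trades \<open>vx\<close>, \<open>as\<close> for \<open>va\<close>,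
  the second \<open>vy\<close>, \<open>bt\<close> for \<open>vb\<close>; \<open>T0\<close>,
  \<open>T1\<close>, \<open>T2\<close> are the stages. The constant is 4 * 2^2 * 312: 4 from the
  placements, a factor 2 per switching and 312 leaf pairs per final graph. The bound 24 is 12 * (1 +
  1), since in \<open>N\<close> a vertex has at most one leaf neighbour.\<close>

lemma leaf_switching:
  assumes M: "56 * D\<^sup>2 \<le> M1" "0 < M1"
    and L: "L = {i \<in> {1..n}. d i = 1}" "24 \<le> card L"
  shows "card {E \<in> \<Omega>. leaf_pairs E = {}} * (M2 * (card L)\<^sup>2)
    \<le> 4992 * M1\<^sup>2 * card {E \<in> \<Omega>. leaf_pairs E \<noteq> {}}"
proof -
  define N where "N = {E \<in> \<Omega>. leaf_pairs E = {}}"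
  define S where "S = {E \<in> \<Omega>. leaf_pairs E \<noteq> {}}"
  define R where "R = (\<lambda>(v :: nat, a, b). d a = 1 \<and> d b = 1)"
  \<comment> \<open>The vertices forgotten by the next switching come first, in the order required
    by \<open>config_step\<close>: \<open>x\<close>, \<open>s\<close>, later \<open>y\<close>,
    \<open>t\<close>. The last set lists the edges still to be created.\<close>
  define T0 where "T0 = {(E, x, s, (y, t, v, a, b)). config N 0 E [v, x, y, a, s, b, t]
      {{v, x}, {v, y}, {a, s}, {b, t}} {{v, a}, {v, b}} \<and> R (v, a, b)}"
  define T1 where "T1 = {(E, y, t, (v, a, b)). config N 3 E [v, y, a, b, t]
      {{v, a}, {v, y}, {b, t}} {{v, b}} \<and> R (v, a, b)}"
  define T2 where "T2 = {(E, (v, a, b)). config N 6 E [v, a, b] {{v, a}, {v, b}} {} \<and> R (v, a, b)}"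
  let ?V = "{1..n}"
  have fin\<Omega>: "finite \<Omega>" by (rule finite_realizations)
  have fin0: "finite T0"
    by (rule finite_subset[of _ "\<Omega> \<times> ?V \<times> ?V \<times> ?V \<times> ?V \<times> ?V \<times> ?V \<times> ?V"])
      (use fin\<Omega> in \<open>auto simp: T0_def config_def near_def\<close>)
  have fin1: "finite T1"
    by (rule finite_subset[of _ "\<Omega> \<times> ?V \<times> ?V \<times> ?V \<times> ?V \<times> ?V"])
      (use fin\<Omega> in \<open>auto simp: T1_def config_def near_def\<close>)
  have fin2: "finite T2"
    by (rule finite_subset[of _ "\<Omega> \<times> ?V \<times> ?V \<times> ?V"])
      (use fin\<Omega> in \<open>auto simp: T2_def config_def near_def\<close>)

  have L_fin: "finite L" by (simp add: L(1))
  have deg: "card (nbrs E a) \<le> 2" if "E \<in> N" "a \<in> L" for E a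
    using that card_nbrs_realization[of E a] by (simp add: L(1) N_def)
  have K: "card {a \<in> L. {z, a} \<in> E} \<le> 1" if "E \<in> N" for E z
  proof -
    have E: "E \<in> \<Omega>" "leaf_pairs E = {}" using that by (simp_all add: N_def)
    show ?thesis
      using finite_nbrs[OF realization_simple[OF E(1)], of z]
      by (intro order_trans[OF card_mono card_leaf_nbrs_le[OF E]]) (auto simp: L(1) nbrs_def)
  qed
  have "card N * (M2 * (card L)\<^sup>2) \<le> 4 * card (Sigma N (placements L))"
    using L(2) by (intro card_Sigma_placements_ge[OF _ L_fin deg K]) (auto simp: N_def)
  also have "card (Sigma N (placements L)) \<le> card T0"
  proof -
    define f where "f = (\<lambda>E a. SOME s. s \<in> nbrs E a)"
    have f: "f E a \<in> nbrs E a" if "E \<in> N" "a \<in> L" for E a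
    proof -
      have "card (nbrs E a) = 1"
        using that card_nbrs_realization[of E a] by (simp add: L(1) N_def)
      then show ?thesis unfolding f_def by (auto simp: card_1_singleton_iff)
    qed
    define g where "g = (\<lambda>(E, ((v :: nat, x :: nat, y :: nat), a, b)). (E, x, f E a, (y, f E b, v, a, b)))"
    have "inj_on g (Sigma N (placements L))"
      by (auto simp: inj_on_def g_def)
    moreover have "g ` Sigma N (placements L) \<subseteq> T0"
    proof (rule image_subsetI)
      fix \<tau> assume "\<tau> \<in> Sigma N (placements L)"
      moreover obtain E v x y a b where \<tau>: "\<tau> = (E, ((v, x, y), a, b))" by (cases \<tau>) auto
      ultimately have E: "E \<in> N" and vxy: "{v, x} \<in> E" "{v, y} \<in> E" "x \<noteq> y"
        and ab: "a \<in> L" "b \<in> L" and far: "far E {v, x, y} a" "far E ({v, x, y, a} \<union> nbrs E a) b"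
        by (simp_all add: placements_def cherries_def)
      define s where "s = f E a"
      define t where "t = f E b"
      have st: "{a, s} \<in> E" "{b, t} \<in> E" "s \<in> nbrs E a"
        using f[OF E ab(1)] f[OF E ab(2)] by (simp_all add: s_def t_def nbrs_def)
      have E\<Omega>: "E \<in> \<Omega>" using E by (simp add: N_def)
      note ed = simple_graph_edgeD[OF realization_simple[OF E\<Omega>]]
      \<comment> \<open>The vertex \<open>a\<close> is adjacent to \<open>s\<close> but to none of
        \<open>v\<close>, \<open>x\<close>, \<open>y\<close>; likewise for \<open>b\<close> and
        \<open>t\<close> below.\<close>
      have avoid: "z \<noteq> s" if "z \<in> {v, x, y}" for z
        using far(1) that st(1) by (auto simp: far_def insert_commute)
      have avoid': "z \<noteq> t" if "z \<in> {v, x, y, a, s}" for z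
        using far(2) that st(2,3) by (auto simp: far_def insert_commute)
      have dist: "distinct [v, x, y, a, s, b, t]"
        using vxy(3) ed(3)[OF vxy(1)] ed(3)[OF vxy(2)] ed(3)[OF st(1)] ed(3)[OF st(2)]
          avoid avoid' far st(3) by (auto simp: far_def)
      have non: "{v, a} \<notin> E" "{v, b} \<notin> E" using far by (simp_all add: far_def)
      have "set [v, x, y, a, s, b, t] \<subseteq> {1..n}"
        using ed(1,2)[OF vxy(1)] ed(2)[OF vxy(2)] ed(1,2)[OF st(1)] ed(1,2)[OF st(2)] by simp
      moreover have "E \<in> near N 0"
        using E E\<Omega> unfolding near_def by (auto intro!: bexI[of _ E])
      ultimately have "config N 0 E [v, x, y, a, s, b, t]
          {{v, x}, {v, y}, {a, s}, {b, t}} {{v, a}, {v, b}}"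
        using dist vxy st non unfolding config_def by simp
      then show "g \<tau> \<in> T0"
        using ab by (simp add: T0_def R_def \<tau> g_def s_def t_def L(1))
    qed
    ultimately show ?thesis using fin0 by (rule card_inj_on_le)
  qed
  also have "card T0 \<le> 2 * M1 * card T1"
  proof -
    let ?vs = "\<lambda>x s (y, t, v, a, b). [v, x, y, a, s, b, t]"
    let ?F = "\<lambda>x s (y, t, v, a, b). {{v, x}, {v, y}, {a, s}, {b, t}}"
    let ?K = "\<lambda>(x :: nat) (s :: nat) (y :: nat, t :: nat, v :: nat, a, b). {{v, a}, {v, b}}"
    let ?R = "\<lambda>(y :: nat, t :: nat, c). R c"
    let ?vs' = "\<lambda>(y, t, v, a, b). [v, y, a, b, t]"
    let ?F' = "\<lambda>(y, t, v, a, b). {{v, a}, {v, y}, {b, t}}"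
    let ?K' = "\<lambda>(y :: nat, t :: nat, v :: nat, a :: nat, b). {{v, b}}"
    have eq: "T0 = {(E, x, s, c). config N 0 E (?vs x s c) (?F x s c) (?K x s c) \<and> ?R c}"
      "T1 = {(E, c). config N (0 + 3) E (?vs' c) (?F' c) (?K' c) \<and> ?R c}"
      by (auto simp: T0_def T1_def)
    show ?thesis unfolding eq
    proof (rule config_step[OF M, where u = "\<lambda>(y, t, v, a, b). v" and w = "\<lambda>(y, t, v, a, b). a"], goal_cases)
      case (3 x s c)
      obtain y t v a b where c: "c = (y, t, v, a, b)" by (cases c) auto
      \<comment> \<open>Listing the vertices in both orders supplies every inequality in both
        orientations.\<close>
      have "distinct (?vs x s c)" "distinct (rev (?vs x s c))"
        using 3 by (simp_all only: distinct_rev)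
      then show ?case by (simp add: c doubleton_eq_iff)
    qed (use fin0 fin1 in \<open>simp_all only: eq[symmetric]\<close>)
  qed
  also have "card T1 \<le> 2 * M1 * card T2"
  proof -
    let ?vs = "\<lambda>y t (v, a, b). [v, y, a, b, t]"
    let ?F = "\<lambda>y t (v, a, b). {{v, a}, {v, y}, {b, t}}"
    let ?K = "\<lambda>(y :: nat) (t :: nat) (v :: nat, a :: nat, b). {{v, b}}"
    let ?vs' = "\<lambda>(v, a, b). [v, a, b]"
    let ?F' = "\<lambda>(v, a, b). {{v, a}, {v, b}}"
    let ?K' = "\<lambda>(v :: nat, a :: nat, b :: nat). {} :: nat set set"
    have eq: "T1 = {(E, y, t, c). config N 3 E (?vs y t c) (?F y t c) (?K y t c) \<and> R c}"
      "T2 = {(E, c). config N (3 + 3) E (?vs' c) (?F' c) (?K' c) \<and> R c}"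
      by (auto simp: T1_def T2_def)
    show ?thesis unfolding eq
    proof (rule config_step[OF M, where u = "\<lambda>(v, a, b). v" and w = "\<lambda>(v, a, b). b"], goal_cases)
      case (3 x s c)
      obtain v a b where c: "c = (v, a, b)" by (cases c) auto
      have "distinct (?vs x s c)" "distinct (rev (?vs x s c))"
        using 3 by (simp_all only: distinct_rev)
      then show ?case by (simp add: c doubleton_eq_iff)
    qed (use fin1 fin2 in \<open>simp_all only: eq[symmetric]\<close>)
  qed
  \<comment> \<open>Two switchings add at most 6 edges in all, and what is left of a configuration
    is a leaf pair, so the graph lies in \<open>S\<close> and close to \<open>N\<close>.\<close>
  also have "card T2 \<le> card (SIGMA E:S \<inter> near N 6. leaf_pairs E)"
  proof (rule card_mono)
    show "T2 \<subseteq> (SIGMA E:S \<inter> near N 6. leaf_pairs E)"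
      by (auto simp: T2_def config_def R_def S_def leaf_pairs_def near_def)
    have "finite (leaf_pairs E)" for E
      by (rule finite_subset[of _ "?V \<times> ?V \<times> ?V"]) (auto simp: leaf_pairs_def)
    then show "finite (SIGMA E:S \<inter> near N 6. leaf_pairs E)" using fin\<Omega> by (simp add: S_def)
  qed
  also have "\<dots> \<le> card (S \<inter> near N 6) * 312"
  proof (rule card_Sigma_le)
    show "finite (leaf_pairs E)" for E
      by (rule finite_subset[of _ "?V \<times> ?V \<times> ?V"]) (auto simp: leaf_pairs_def)
    show "card (leaf_pairs E) \<le> 312" if "E \<in> S \<inter> near N 6" for E
      using that by (intro card_leaf_pairs_le[of _ N]) (auto simp: N_def)
  qed (use fin\<Omega> in \<open>simp add: S_def\<close>)
  also have "card (S \<inter> near N 6) \<le> card S" using fin\<Omega> by (intro card_mono) (auto simp: S_def)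
  finally show ?thesis by (simp add: N_def S_def power2_eq_square algebra_simps)
qed

text \<open>Three switchings create \<open>va\<close> from \<open>vx\<close>, \<open>as\<close>,
  then \<open>vb\<close> from \<open>vy\<close>, \<open>bt\<close>, and finally \<open>ab\<close>
  from \<open>as'\<close>, \<open>bt'\<close>. The constant is 4 * 2^3 * 144. A vertex may have up
  to \<open>D\<close> neighbours of degree 2, hence the bound 12 * (1 + D).\<close>

lemma ear_switching:
  assumes M: "56 * D\<^sup>2 \<le> M1" "0 < M1"
    and L: "L = {i \<in> {1..n}. d i = 2}" "12 * (1 + D) \<le> card L"
  shows "card {E \<in> \<Omega>. ears E = {}} * (M2 * (card L)\<^sup>2)
    \<le> 4608 * M1 ^ 3 * card {E \<in> \<Omega>. ears E \<noteq> {}}"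
proof -
  define N where "N = {E \<in> \<Omega>. ears E = {}}"
  define S where "S = {E \<in> \<Omega>. ears E \<noteq> {}}"
  define R where "R = (\<lambda>(v :: nat, a, b). d a = 2 \<and> d b = 2)"
  \<comment> \<open>These nine vertices form the longest list, the reason for the bound 9 in
    \<open>config_step\<close>.\<close>
  define T0 where "T0 = {(E, x, s, (y, t, s', t', v, a, b)). config N 0 E [v, x, y, a, s, s', b, t, t']
      {{v, x}, {v, y}, {a, s}, {a, s'}, {b, t}, {b, t'}} {{v, a}, {v, b}, {a, b}} \<and> R (v, a, b)}"
  define T1 where "T1 = {(E, y, t, (s', t', v, a, b)). config N 3 E [v, y, a, s', b, t, t']
      {{v, a}, {v, y}, {a, s'}, {b, t}, {b, t'}} {{v, b}, {a, b}} \<and> R (v, a, b)}"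
  define T2 where "T2 = {(E, s', t', (v, a, b)). config N 6 E [v, a, s', b, t']
      {{v, a}, {v, b}, {a, s'}, {b, t'}} {{a, b}} \<and> R (v, a, b)}"
  define T3 where "T3 = {(E, (v, a, b)). config N 9 E [v, a, b] {{v, a}, {v, b}, {a, b}} {} \<and> R (v, a, b)}"
  let ?V = "{1..n}"
  have fin\<Omega>: "finite \<Omega>" by (rule finite_realizations)
  have fin0: "finite T0"
    by (rule finite_subset[of _ "\<Omega> \<times> ?V \<times> ?V \<times> ?V \<times> ?V \<times> ?V \<times> ?V \<times> ?V \<times> ?V \<times> ?V"])
      (use fin\<Omega> in \<open>auto simp: T0_def config_def near_def\<close>)
  have fin1: "finite T1"
    by (rule finite_subset[of _ "\<Omega> \<times> ?V \<times> ?V \<times> ?V \<times> ?V \<times> ?V \<times> ?V \<times> ?V"])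
      (use fin\<Omega> in \<open>auto simp: T1_def config_def near_def\<close>)
  have fin2: "finite T2"
    by (rule finite_subset[of _ "\<Omega> \<times> ?V \<times> ?V \<times> ?V \<times> ?V \<times> ?V"])
      (use fin\<Omega> in \<open>auto simp: T2_def config_def near_def\<close>)
  have fin3: "finite T3"
    by (rule finite_subset[of _ "\<Omega> \<times> ?V \<times> ?V \<times> ?V"])
      (use fin\<Omega> in \<open>auto simp: T3_def config_def near_def\<close>)
  have L_fin: "finite L" by (simp add: L(1))
  have deg: "card (nbrs E a) \<le> 2" if "E \<in> N" "a \<in> L" for E a
    using that card_nbrs_realization[of E a] by (simp add: L(1) N_def)
  have K: "card {a \<in> L. {z, a} \<in> E} \<le> D" if "E \<in> N" for E z
  proof -
    have E: "E \<in> \<Omega>" using that by (simp add: N_def)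
    show ?thesis
      using finite_nbrs[OF realization_simple[OF E], of z]
      by (intro order_trans[OF card_mono card_nbrs_le[OF E, of z]]) (auto simp: nbrs_def)
  qed
  have "card N * (M2 * (card L)\<^sup>2) \<le> 4 * card (Sigma N (placements L))"
    using L(2) by (intro card_Sigma_placements_ge[OF _ L_fin deg K]) (auto simp: N_def)
  also have "card (Sigma N (placements L)) \<le> card T0"
  proof -
    \<comment> \<open>An ordering of the two neighbours of a vertex of degree 2: the first is given
      up for the edge to \<open>v\<close>, the second for the edge \<open>ab\<close>.\<close>
    define f where "f = (\<lambda>E a. SOME (s, s'). nbrs E a = {s, s'} \<and> s \<noteq> s')"
    have f: "nbrs E a = {fst (f E a), snd (f E a)} \<and> fst (f E a) \<noteq> snd (f E a)"
      if "E \<in> N" "a \<in> L" for E a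
    proof -
      have "card (nbrs E a) = 2"
        using that card_nbrs_realization[of E a] by (simp add: L(1) N_def)
      then obtain s s' where "nbrs E a = {s, s'} \<and> s \<noteq> s'" by (auto simp: card_2_iff)
      then have "case (s, s') of (s, s') \<Rightarrow> nbrs E a = {s, s'} \<and> s \<noteq> s'" by simp
      then have "case f E a of (s, s') \<Rightarrow> nbrs E a = {s, s'} \<and> s \<noteq> s'"
        unfolding f_def by (rule someI)
      then show ?thesis by (simp add: case_prod_beta)
    qed
    define g where "g = (\<lambda>(E, ((v :: nat, x :: nat, y :: nat), a, b)).
      (E, x, fst (f E a), (y, fst (f E b), snd (f E a), snd (f E b), v, a, b)))"
    have "inj_on g (Sigma N (placements L))"
      by (auto simp: inj_on_def g_def)
    moreover have "g ` Sigma N (placements L) \<subseteq> T0"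
    proof (rule image_subsetI)
      fix \<tau> assume "\<tau> \<in> Sigma N (placements L)"
      moreover obtain E v x y a b where \<tau>: "\<tau> = (E, ((v, x, y), a, b))" by (cases \<tau>) auto
      ultimately have E: "E \<in> N" and vxy: "{v, x} \<in> E" "{v, y} \<in> E" "x \<noteq> y"
        and ab: "a \<in> L" "b \<in> L" and far: "far E {v, x, y} a" "far E ({v, x, y, a} \<union> nbrs E a) b"
        by (simp_all add: placements_def cherries_def)
      define s s' where "s = fst (f E a)" and "s' = snd (f E a)"
      define t t' where "t = fst (f E b)" and "t' = snd (f E b)"
      have nb: "nbrs E a = {s, s'}" "s \<noteq> s'" "nbrs E b = {t, t'}" "t \<noteq> t'"
        using f[OF E ab(1)] f[OF E ab(2)] by (simp_all add: s_def s'_def t_def t'_def)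
      then have "s \<in> nbrs E a" "s' \<in> nbrs E a" "t \<in> nbrs E b" "t' \<in> nbrs E b" by simp_all
      then have st: "{a, s} \<in> E" "{a, s'} \<in> E" "{b, t} \<in> E" "{b, t'} \<in> E"
        by (simp_all add: nbrs_def)
      have E\<Omega>: "E \<in> \<Omega>" using E by (simp add: N_def)
      note ed = simple_graph_edgeD[OF realization_simple[OF E\<Omega>]]
      have avoid: "z \<noteq> s" "z \<noteq> s'" if "z \<in> {v, x, y}" for z
        using far(1) that st by (auto simp: far_def insert_commute)
      have far': "z \<noteq> b" "{z, b} \<notin> E" if "z \<in> {v, x, y, a, s, s'}" for z
        using far(2) that unfolding far_def nb by blast+
      have avoid': "z \<noteq> t" "z \<noteq> t'" if "z \<in> {v, x, y, a, s, s'}" for z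
        using far'(2)[OF that] st(3,4) by (auto simp: insert_commute)
      have dist: "distinct [v, x, y, a, s, s', b, t, t']"
        using vxy(3) ed(3)[OF vxy(1)] ed(3)[OF vxy(2)] ed(3)[OF st(1)] ed(3)[OF st(2)]
          ed(3)[OF st(3)] ed(3)[OF st(4)] avoid avoid' far'(1) far(1) nb(2,4)
        by (auto simp: far_def)
      have non: "{v, a} \<notin> E" "{v, b} \<notin> E" "{a, b} \<notin> E"
        using far(1) far'(2)[of v] far'(2)[of a] by (simp_all add: far_def)
      have "set [v, x, y, a, s, s', b, t, t'] \<subseteq> {1..n}"
        using ed(1,2)[OF vxy(1)] ed(2)[OF vxy(2)] ed(1,2)[OF st(1)] ed(2)[OF st(2)]
          ed(1,2)[OF st(3)] ed(2)[OF st(4)] by simp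
      moreover have "E \<in> near N 0"
        using E E\<Omega> unfolding near_def by (auto intro!: bexI[of _ E])
      ultimately have "config N 0 E [v, x, y, a, s, s', b, t, t']
          {{v, x}, {v, y}, {a, s}, {a, s'}, {b, t}, {b, t'}} {{v, a}, {v, b}, {a, b}}"
        using dist vxy st non unfolding config_def by simp
      then show "g \<tau> \<in> T0"
        using ab by (simp add: T0_def R_def \<tau> g_def s_def s'_def t_def t'_def L(1))
    qed
    ultimately show ?thesis using fin0 by (rule card_inj_on_le)
  qed
  also have "card T0 \<le> 2 * M1 * card T1"
  proof -
    let ?vs = "\<lambda>x s (y, t, s', t', v, a, b). [v, x, y, a, s, s', b, t, t']"
    let ?F = "\<lambda>x s (y, t, s', t', v, a, b). {{v, x}, {v, y}, {a, s}, {a, s'}, {b, t}, {b, t'}}"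
    let ?K = "\<lambda>(x :: nat) (s :: nat) (y :: nat, t :: nat, s' :: nat, t' :: nat, v :: nat, a, b).
      {{v, a}, {v, b}, {a, b}}"
    let ?R = "\<lambda>(y :: nat, t :: nat, s' :: nat, t' :: nat, c). R c"
    let ?vs' = "\<lambda>(y, t, s', t', v, a, b). [v, y, a, s', b, t, t']"
    let ?F' = "\<lambda>(y, t, s', t', v, a, b). {{v, a}, {v, y}, {a, s'}, {b, t}, {b, t'}}"
    let ?K' = "\<lambda>(y :: nat, t :: nat, s' :: nat, t' :: nat, v :: nat, a :: nat, b). {{v, b}, {a, b}}"
    have eq: "T0 = {(E, x, s, c). config N 0 E (?vs x s c) (?F x s c) (?K x s c) \<and> ?R c}"
      "T1 = {(E, c). config N (0 + 3) E (?vs' c) (?F' c) (?K' c) \<and> ?R c}"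
      by (auto simp: T0_def T1_def)
    show ?thesis unfolding eq
    proof (rule config_step[OF M, where u = "\<lambda>(y, t, s', t', v, a, b). v"
          and w = "\<lambda>(y, t, s', t', v, a, b). a"], goal_cases)
      case (3 x s c)
      obtain y t s' t' v a b where c: "c = (y, t, s', t', v, a, b)" by (cases c) auto
      have "distinct (?vs x s c)" "distinct (rev (?vs x s c))"
        using 3 by (simp_all only: distinct_rev)
      then show ?case by (simp add: c doubleton_eq_iff)
    qed (use fin0 fin1 in \<open>simp_all only: eq[symmetric]\<close>)
  qed
  also have "card T1 \<le> 2 * M1 * card T2"
  proof -
    let ?vs = "\<lambda>y t (s', t', v, a, b). [v, y, a, s', b, t, t']"
    let ?F = "\<lambda>y t (s', t', v, a, b). {{v, a}, {v, y}, {a, s'}, {b, t}, {b, t'}}"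
    let ?K = "\<lambda>(y :: nat) (t :: nat) (s' :: nat, t' :: nat, v :: nat, a :: nat, b). {{v, b}, {a, b}}"
    let ?R = "\<lambda>(s' :: nat, t' :: nat, c). R c"
    let ?vs' = "\<lambda>(s', t', v, a, b). [v, a, s', b, t']"
    let ?F' = "\<lambda>(s', t', v, a, b). {{v, a}, {v, b}, {a, s'}, {b, t'}}"
    let ?K' = "\<lambda>(s' :: nat, t' :: nat, v :: nat, a :: nat, b). {{a, b}}"
    have eq: "T1 = {(E, y, t, c). config N 3 E (?vs y t c) (?F y t c) (?K y t c) \<and> ?R c}"
      "T2 = {(E, c). config N (3 + 3) E (?vs' c) (?F' c) (?K' c) \<and> ?R c}"
      by (auto simp: T1_def T2_def)
    show ?thesis unfolding eq
    proof (rule config_step[OF M, where u = "\<lambda>(s', t', v, a, b). v" and w = "\<lambda>(s', t', v, a, b). b"], goal_cases)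
      case (3 x s c)
      obtain s' t' v a b where c: "c = (s', t', v, a, b)" by (cases c) auto
      have "distinct (?vs x s c)" "distinct (rev (?vs x s c))"
        using 3 by (simp_all only: distinct_rev)
      then show ?case by (simp add: c doubleton_eq_iff)
    qed (use fin1 fin2 in \<open>simp_all only: eq[symmetric]\<close>)
  qed
  also have "card T2 \<le> 2 * M1 * card T3"
  proof -
    let ?vs = "\<lambda>s' t' (v, a, b). [v, a, s', b, t']"
    let ?F = "\<lambda>s' t' (v, a, b). {{v, a}, {v, b}, {a, s'}, {b, t'}}"
    let ?K = "\<lambda>(s' :: nat) (t' :: nat) (v :: nat, a :: nat, b). {{a, b}}"
    let ?vs' = "\<lambda>(v, a, b). [v, a, b]"
    let ?F' = "\<lambda>(v, a, b). {{v, a}, {v, b}, {a, b}}"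
    let ?K' = "\<lambda>(v :: nat, a :: nat, b :: nat). {} :: nat set set"
    have eq: "T2 = {(E, s', t', c). config N 6 E (?vs s' t' c) (?F s' t' c) (?K s' t' c) \<and> R c}"
      "T3 = {(E, c). config N (6 + 3) E (?vs' c) (?F' c) (?K' c) \<and> R c}"
      by (auto simp: T2_def T3_def)
    show ?thesis unfolding eq
    proof (rule config_step[OF M, where u = "\<lambda>(v, a, b). a" and w = "\<lambda>(v, a, b). b"], goal_cases)
      case (3 x s c)
      obtain v a b where c: "c = (v, a, b)" by (cases c) auto
      have "distinct (?vs x s c)" "distinct (rev (?vs x s c))"
        using 3 by (simp_all only: distinct_rev)
      then show ?case by (simp add: c doubleton_eq_iff)
    qed (use fin2 fin3 in \<open>simp_all only: eq[symmetric]\<close>)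
  qed
  also have "card T3 \<le> card (SIGMA E:S \<inter> near N 9. ears E)"
  proof (rule card_mono)
    show "T3 \<subseteq> (SIGMA E:S \<inter> near N 9. ears E)"
      by (auto simp: T3_def config_def R_def S_def ears_def near_def)
    have "finite (ears E)" for E
      by (rule finite_subset[of _ "?V \<times> ?V \<times> ?V"]) (auto simp: ears_def)
    then show "finite (SIGMA E:S \<inter> near N 9. ears E)" using fin\<Omega> by (simp add: S_def)
  qed
  also have "\<dots> \<le> card (S \<inter> near N 9) * 144"
  proof (rule card_Sigma_le)
    show "finite (ears E)" for E
      by (rule finite_subset[of _ "?V \<times> ?V \<times> ?V"]) (auto simp: ears_def)
    show "card (ears E) \<le> 144" if "E \<in> S \<inter> near N 9" for E
      using that by (intro card_ears_le[of _ N]) (auto simp: N_def)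
  qed (use fin\<Omega> in \<open>simp add: S_def\<close>)
  also have "card (S \<inter> near N 9) \<le> card S" using fin\<Omega> by (intro card_mono) (auto simp: S_def)
  finally show ?thesis by (simp add: N_def S_def power3_eq_cube algebra_simps)
qed

end

section \<open>Asymptotics\<close>

lemma prob_symmetric_ge:
  fixes r :: real
  assumes "degree_sequence n d" "0 \<le> r"
    and sym: "\<And>E. E \<in> realizations n d \<Longrightarrow> P E \<Longrightarrow> symmetric_graph n E"
    and r: "real (card {E \<in> realizations n d. \<not> P E}) * r \<le> real (card {E \<in> realizations n d. P E})"
  shows "r / (1 + r) \<le> prob_symmetric n d"
proof -
  let ?\<Omega> = "realizations n d"
  let ?N = "{E \<in> ?\<Omega>. \<not> P E}" and ?S = "{E \<in> ?\<Omega>. P E}"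
  have fin: "finite ?\<Omega>" and ne: "?\<Omega> \<noteq> {}"
    using assms(1) by (simp_all add: finite_realizations degree_sequence_def)
  have "card (?N \<union> ?S) = card ?N + card ?S"
    using fin by (intro card_Un_disjoint) auto
  moreover have "?N \<union> ?S = ?\<Omega>" by blast
  ultimately have total: "real (card ?\<Omega>) = real (card ?N) + real (card ?S)" by simp
  have pos: "0 < real (card ?\<Omega>)" using fin ne by (simp add: card_gt_0_iff)
  \<comment> \<open>Adding \<open>r\<close> times the number of graphs satisfying \<open>P\<close>
    to both sides of the hypothesis turns the ratio into a proportion.\<close>
  have "r * real (card ?\<Omega>) \<le> real (card ?S) * (1 + r)"
    using r unfolding total by (simp add: algebra_simps)
  then have "r / (1 + r) \<le> real (card ?S) / real (card ?\<Omega>)"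
    using pos assms(2) by (simp add: divide_simps mult.commute)
  also have "\<dots> \<le> real (card (?\<Omega> \<inter> {E. symmetric_graph n E})) / real (card ?\<Omega>)"
    using sym fin by (intro divide_right_mono of_nat_mono card_mono) auto
  also have "\<dots> = prob_symmetric n d"
    unfolding prob_symmetric_def random_graph_def by (rule measure_pmf_of_set[OF ne fin, symmetric])
  finally show ?thesis .
qed

text \<open>Vertex 1 and its only neighbour form a component, so its two endpoints can be
  swapped.\<close>

lemma symmetric_graph_perfect_matching:
  assumes E: "E \<in> realizations n d" and "1 \<le> n" and d: "\<And>i. i \<in> {1..n} \<Longrightarrow> d i = 1"
  shows "symmetric_graph n E"
proof -
  interpret bounded_degrees n d 1 by unfold_locales (simp add: d)
  note simple = realization_simple[OF E]
  have nb: "card (nbrs E v) = 1" if "v \<in> {1..n}" for v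
    using card_nbrs_realization[OF E that] d[OF that] by simp
  have "1 \<in> {1..n}" using \<open>1 \<le> n\<close> by simp
  from nb[OF this] obtain w where w: "nbrs E 1 = {w}" by (rule card_1_singletonE)
  then have edge: "{1, w} \<in> E" by (auto simp: nbrs_def)
  note ed = simple_graph_edgeD[OF simple edge]
  from nb[OF ed(2)] obtain u where "nbrs E w = {u}" by (rule card_1_singletonE)
  moreover have "1 \<in> nbrs E w" using edge by (simp add: nbrs_iff)
  ultimately have w': "nbrs E w = {1}" by simp
  show ?thesis
  proof (rule symmetric_graph_swap[OF simple ed])
    show "{z, 1} \<in> E \<longleftrightarrow> {z, w} \<in> E" if "z \<noteq> 1" "z \<noteq> w" for z
      using that w w' unfolding nbrs_iff[symmetric] by simp
  qed
qed

text \<open>In the sparsity constant, 56 makes the switchings possible, 576 / c^2 forces at least 24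
  leaves in the first case, and 24 / c forces at least 24 * D vertices of degree 2 in the second.
  The 5000 exceeds both switching constants, 4992 and 4608.\<close>

lemma prob_symmetric_lower_bound:
  fixes c :: real
  assumes deg: "degree_sequence n d" and n: "1 \<le> n" and d_pos: "\<And>i. i \<in> {1..n} \<Longrightarrow> 1 \<le> d i"
    and c: "0 < c"
    and sparse: "(56 + 576 / c\<^sup>2 + 24 / c) * (max_degree n d)\<^sup>2 \<le> degree_moment 1 n d"
    and thr: "degree_count 1 n d > c * threshold1 n d \<or> degree_count 2 n d > c * threshold2 n d"
  shows "(c\<^sup>2 / 5000) / (1 + c\<^sup>2 / 5000) \<le> prob_symmetric n d"
proof -
  define D where "D = Max (d ` {1..n})"
  interpret bounded_degrees n d D by unfold_locales (simp add: D_def)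
  let ?\<Omega> = "realizations n d"
  let ?K = "56 + 576 / c\<^sup>2 + 24 / c"
  define m1 m2 where "m1 = real M1" and "m2 = real M2"
  have m1: "degree_moment 1 n d = m1"
    by (simp add: m1_def M1_def degree_moment_def falling_factorial_def)
  \<comment> \<open>The truncated subtraction at k = 0 does no harm, because the other factor
    vanishes.\<close>
  have "real (k * (k - 1)) = falling_factorial (real k) 2" for k
    by (cases k) (simp_all add: falling_factorial_def numeral_2_eq_2 algebra_simps)
  then have m2: "degree_moment 2 n d = m2"
    by (simp only: m2_def M2_def degree_moment_def of_nat_sum)
  have D: "max_degree n d = real D" by (simp add: max_degree_def D_def)
  have "d 1 \<le> D" using n by (intro d_le) simp
  then have D1: "1 \<le> real D" using d_pos[of 1] n by simp
  have K: "56 \<le> ?K" "576 / c\<^sup>2 \<le> ?K" "24 / c \<le> ?K" using c by simp_all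
  have sp: "?K * (real D)\<^sup>2 \<le> m1" using sparse by (simp only: m1 D)
  have "56 * (real D)\<^sup>2 \<le> ?K * (real D)\<^sup>2" using K(1) by (rule mult_right_mono) simp
  then have "real (56 * D\<^sup>2) \<le> real M1" using sp by (simp add: m1_def)
  then have M: "56 * D\<^sup>2 \<le> M1" by (simp only: of_nat_le_iff)
  have "0 < 56 * D\<^sup>2" using D1 by simp
  then have M1_pos: "0 < M1" using M by linarith
  then have m1_pos: "0 < m1" by (simp add: m1_def)
  have "d i * (d i - 1) \<le> D * d i" if "i \<in> {1..n}" for i
    using mult_le_mono1[of "d i - 1" D "d i"] d_le[OF that] by (subst mult.commute) linarith
  then have "M2 \<le> (\<Sum>i=1..n. D * d i)" unfolding M2_def by (rule sum_mono)
  then have "M2 \<le> D * M1" by (simp add: M1_def sum_distrib_left)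
  then have m2_le: "m2 \<le> real D * m1"
    unfolding m1_def m2_def by (simp only: of_nat_mult[symmetric] of_nat_le_iff)
  show ?thesis
  proof (cases "M2 = 0")
    \<comment> \<open>All degrees are 1 and both thresholds are 0 through division by zero. Every
      realization is a symmetric perfect matching, so no graph is left on the bad side.\<close>
    case True
    have "d i = 1" if "i \<in> {1..n}" for i
    proof -
      have "d i * (d i - 1) = 0" using True that unfolding M2_def by simp
      then show ?thesis using d_pos[OF that] by auto
    qed
    then have "symmetric_graph n E" if "E \<in> ?\<Omega>" for E
      using symmetric_graph_perfect_matching[OF that n] by blast
    then show ?thesis by (intro prob_symmetric_ge[OF deg, where P = "\<lambda>_. True"]) simp_all
  next
    case False
    then have m2_pos: "0 < m2" by (simp add: m2_def)
    from thr show ?thesis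
    proof
      define L where "L = {i \<in> {1..n}. d i = 1}"
      define l where "l = real (card L)"
      assume "degree_count 1 n d > c * threshold1 n d"
      then have "c * (m1 / sqrt m2) \<le> l"
        by (simp add: degree_count_def threshold1_def l_def L_def m1[simplified] m2)
      then have "c * m1 \<le> l * sqrt m2"
        using m2_pos by (simp add: divide_simps)
      then have "(c * m1)\<^sup>2 \<le> (l * sqrt m2)\<^sup>2"
        using c m1_pos by (intro power_mono) simp_all
      \<comment> \<open>Besides entering the final estimate, this yields 24 leaves: with m2 <= D *
        m1 it gives c^2 * m1 <= l^2 * D, and sparsity gives 576 * D^2 <= c^2 * m1, so 576 * D <=
        l^2.\<close>
      then have key: "c\<^sup>2 * m1\<^sup>2 \<le> l\<^sup>2 * m2" using m2_pos by (simp add: power_mult_distrib)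
      also have "\<dots> \<le> l\<^sup>2 * (real D * m1)" using m2_le by (rule mult_left_mono) simp
      finally have "(c\<^sup>2 * m1) * m1 \<le> (l\<^sup>2 * real D) * m1" by (simp add: power2_eq_square algebra_simps)
      then have "c\<^sup>2 * m1 \<le> l\<^sup>2 * real D" using m1_pos by simp
      moreover have "576 * (real D)\<^sup>2 \<le> c\<^sup>2 * m1"
      proof -
        have "576 / c\<^sup>2 * (real D)\<^sup>2 \<le> m1"
          using mult_right_mono[OF K(2), of "(real D)\<^sup>2"] sp by simp
        then show ?thesis using c by (simp add: field_simps)
      qed
      ultimately have "(576 * real D) * real D \<le> l\<^sup>2 * real D" by (simp add: power2_eq_square)
      then have "576 * real D \<le> l\<^sup>2" using D1 by simp
      then have "24\<^sup>2 \<le> l\<^sup>2" using D1 by simp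
      then have "24 \<le> l" by (rule power2_le_imp_le) (simp add: l_def)
      then have L24: "24 \<le> card L" by (simp add: l_def)
      let ?N = "real (card {E \<in> ?\<Omega>. leaf_pairs E = {}})"
      let ?S = "real (card {E \<in> ?\<Omega>. leaf_pairs E \<noteq> {}})"
      have "?N * (m2 * l\<^sup>2) \<le> 4992 * m1\<^sup>2 * ?S"
        using leaf_switching[OF M M1_pos L_def L24, THEN of_nat_mono, where 'a = real]
        by (simp add: m1_def m2_def l_def)
      moreover have "?N * (c\<^sup>2 * m1\<^sup>2) \<le> ?N * (m2 * l\<^sup>2)"
        using key by (intro mult_left_mono) (simp_all add: mult.commute)
      ultimately have "(?N * c\<^sup>2) * m1\<^sup>2 \<le> (4992 * ?S) * m1\<^sup>2" by (simp add: algebra_simps)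
      then have "?N * c\<^sup>2 \<le> 4992 * ?S" using m1_pos by simp
      then have "?N * (c\<^sup>2 / 5000) \<le> ?S" by simp
      then show ?thesis
        using symmetric_if_leaf_pair
        by (intro prob_symmetric_ge[OF deg, where P = "\<lambda>E. leaf_pairs E \<noteq> {}"]) simp_all
    next
      define L where "L = {i \<in> {1..n}. d i = 2}"
      define l where "l = real (card L)"
      have m_pos: "0 < m1 ^ 3 / m2" using m1_pos m2_pos by simp
      assume "degree_count 2 n d > c * threshold2 n d"
      then have "c * sqrt (m1 ^ 3 / m2) \<le> l"
        by (simp only: degree_count_def threshold2_def l_def L_def m1 m2)
      then have "(c * sqrt (m1 ^ 3 / m2))\<^sup>2 \<le> l\<^sup>2"
        using c m_pos by (intro power_mono) simp_all
      then have "c\<^sup>2 * (m1 ^ 3 / m2) \<le> l\<^sup>2" using m_pos by (simp add: power_mult_distrib)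
      \<comment> \<open>As before, c^2 * m1^2 <= l^2 * D follows, and sparsity bounds the left side
        below by (24 * D^2)^2. Hence 24^2 * D^3 <= l^2, so 24 * D <= l, which is at least 12 * (1 +
        D) as D >= 1.\<close>
      then have key: "c\<^sup>2 * m1 ^ 3 \<le> l\<^sup>2 * m2" using m2_pos by (simp add: divide_simps)
      also have "\<dots> \<le> l\<^sup>2 * (real D * m1)" using m2_le by (rule mult_left_mono) simp
      finally have "(c\<^sup>2 * m1\<^sup>2) * m1 \<le> (l\<^sup>2 * real D) * m1"
        by (simp add: power2_eq_square power3_eq_cube algebra_simps)
      then have "c\<^sup>2 * m1\<^sup>2 \<le> l\<^sup>2 * real D" using m1_pos by simp
      moreover have "(24 * (real D)\<^sup>2)\<^sup>2 \<le> (c * m1)\<^sup>2"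
      proof (rule power_mono)
        have "24 / c * (real D)\<^sup>2 \<le> m1"
          using mult_right_mono[OF K(3), of "(real D)\<^sup>2"] sp by simp
        then show "24 * (real D)\<^sup>2 \<le> c * m1" using c by (simp add: field_simps)
      qed simp
      ultimately have "(24 * (real D)\<^sup>2)\<^sup>2 \<le> l\<^sup>2 * real D" by (simp add: power_mult_distrib)
      then have "((24 * real D)\<^sup>2 * real D) * real D \<le> l\<^sup>2 * real D"
        by (simp add: power2_eq_square algebra_simps)
      then have "(24 * real D)\<^sup>2 * real D \<le> l\<^sup>2" using D1 by simp
      moreover have "(24 * real D)\<^sup>2 * 1 \<le> (24 * real D)\<^sup>2 * real D"
        using D1 by (intro mult_left_mono) simp_all
      ultimately have "(24 * real D)\<^sup>2 \<le> l\<^sup>2" by linarith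
      then have "24 * real D \<le> l" by (rule power2_le_imp_le) (simp add: l_def)
      then have "real (24 * D) \<le> real (card L)" by (simp add: l_def)
      then have "24 * D \<le> card L" by (simp only: of_nat_le_iff)
      then have L24: "12 * (1 + D) \<le> card L" using D1 by simp
      let ?N = "real (card {E \<in> ?\<Omega>. ears E = {}})"
      let ?S = "real (card {E \<in> ?\<Omega>. ears E \<noteq> {}})"
      have "?N * (m2 * l\<^sup>2) \<le> 4608 * m1 ^ 3 * ?S"
        using ear_switching[OF M M1_pos L_def L24, THEN of_nat_mono, where 'a = real]
        by (simp add: m1_def m2_def l_def)
      moreover have "?N * (c\<^sup>2 * m1 ^ 3) \<le> ?N * (m2 * l\<^sup>2)"
        using key by (intro mult_left_mono) (simp_all add: mult.commute)
      ultimately have "(?N * c\<^sup>2) * m1 ^ 3 \<le> (4608 * ?S) * m1 ^ 3" by (simp add: algebra_simps)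
      then have "?N * c\<^sup>2 \<le> 4608 * ?S" using m1_pos by simp
      then have "?N * (c\<^sup>2 / 5000) \<le> ?S" by simp
      then show ?thesis
        using symmetric_if_ear
        by (intro prob_symmetric_ge[OF deg, where P = "\<lambda>E. ears E \<noteq> {}"]) simp_all
    qed
  qed
qed

section \<open>Passage to the limit\<close>

lemma eventually_prob_symmetric_ge:
  fixes c :: real
  assumes fam: "degree_family I d" and c: "0 < c"
    and thr: "\<forall>\<^sub>F n in along I. degree_count 1 n (d n) > c * threshold1 n (d n) \<or>
      degree_count 2 n (d n) > c * threshold2 n (d n)"
  shows "\<forall>\<^sub>F n in along I. (c\<^sup>2 / 5000) / (1 + c\<^sup>2 / 5000) \<le> prob_symmetric n (d n)"
proof -
  define K where "K = 56 + 576 / c\<^sup>2 + 24 / c"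
  have K: "0 < K" unfolding K_def using c by (intro add_pos_pos) simp_all
  have "(\<lambda>n. (max_degree n (d n))\<^sup>2) \<in> o[along I](\<lambda>n. degree_moment 1 n (d n))"
    using fam by (simp only: degree_family_def)
  \<comment> \<open>The small-o condition is used with the single constant 1 / K, where
    \<open>K\<close> is the sparsity constant belonging to \<open>c\<close>.\<close>
  then have "\<forall>\<^sub>F n in along I. norm ((max_degree n (d n))\<^sup>2) \<le> (1 / K) * norm (degree_moment 1 n (d n))"
    using K by (intro landau_o.smallD) simp_all
  moreover have "\<forall>\<^sub>F n in along I. n \<in> I \<and> 1 \<le> n"
    unfolding along_def eventually_inf_principal
    using eventually_ge_at_top[of "1 :: nat"] by (rule eventually_mono) simp
  ultimately show ?thesis using thr
  proof eventually_elim
    case (elim n)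
    have "0 \<le> degree_moment 1 n (d n)"
      by (simp add: degree_moment_def falling_factorial_def sum_nonneg)
    then have "(max_degree n (d n))\<^sup>2 \<le> degree_moment 1 n (d n) / K"
      using elim(1) by simp
    then have sparse: "K * (max_degree n (d n))\<^sup>2 \<le> degree_moment 1 n (d n)"
      using K by (simp only: pos_le_divide_eq mult.commute)
    have "degree_sequence n (d n)" "\<And>i. i \<in> {1..n} \<Longrightarrow> 1 \<le> d n i"
      using fam elim(2) unfolding degree_family_def by blast+
    then show ?case
      using elim(2,3) c sparse unfolding K_def by (intro prob_symmetric_lower_bound) blast+
  qed
qed

lemma little_omega_eventually_gt:
  fixes c :: real
  assumes "little_omega F f g" "0 < c"
  shows "\<forall>\<^sub>F n in F. f n > c * g n"
proof -
  \<comment> \<open>The extra factor 2 leaves c * g n at most half of f n, and positivity of f n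
    then makes the inequality strict.\<close>
  have "\<forall>\<^sub>F n in F. norm (g n) \<le> (1 / (2 * c)) * norm (f n)"
    using assms by (intro landau_o.smallD) (simp_all add: little_omega_def)
  moreover have "\<forall>\<^sub>F n in F. f n > 0" using assms(1) by (simp add: little_omega_def)
  ultimately show ?thesis
  proof eventually_elim
    case (elim n)
    have "c * g n \<le> c * \<bar>g n\<bar>" using assms(2) by simp
    also have "\<dots> \<le> c * ((1 / (2 * c)) * f n)"
      using elim assms(2) by (intro mult_left_mono) simp_all
    also have "\<dots> < f n" using elim(2) assms(2) by simp
    finally show ?case .
  qed
qed

lemma prob_symmetric_tendsto_1:
  assumes fam: "degree_family I d"
    and thr: "\<And>c::real. 0 < c \<Longrightarrow> \<forall>\<^sub>F n in along I. degree_count 1 n (d n) > c * threshold1 n (d n) \<or>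
      degree_count 2 n (d n) > c * threshold2 n (d n)"
  shows "((\<lambda>n. prob_symmetric n (d n)) \<longlongrightarrow> 1) (along I)"
proof (rule order_tendstoI)
  fix a :: real assume a: "a < 1"
  \<comment> \<open>This \<open>r\<close> satisfies r * (1 - a) = |a| + 1 > a, that is r / (1 + r) >
    a. As every \<open>c\<close> is allowed, the square root of 5000 * r turns the lower bound into
    r / (1 + r).\<close>
  define r where "r = (\<bar>a\<bar> + 1) / (1 - a)"
  have r: "0 < r" using a by (simp add: r_def)
  have "r * (1 - a) = \<bar>a\<bar> + 1" using a by (simp add: r_def)
  then have "a * (1 + r) < r" by (simp add: algebra_simps)
  then have less: "a < r / (1 + r)" using r by (simp add: pos_less_divide_eq)
  have sq: "(sqrt (5000 * r))\<^sup>2 / 5000 = r" using r by simp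
  have "0 < sqrt (5000 * r)" using r by simp
  from eventually_prob_symmetric_ge[OF fam this thr[OF this]]
  have "\<forall>\<^sub>F n in along I. r / (1 + r) \<le> prob_symmetric n (d n)"
    unfolding sq .
  then show "\<forall>\<^sub>F n in along I. a < prob_symmetric n (d n)"
    by (rule eventually_mono) (use less in linarith)
next
  fix a :: real assume "1 < a"
  moreover have "prob_symmetric n (d n) \<le> 1" for n
    unfolding prob_symmetric_def by (rule measure_pmf.prob_le_1)
  ultimately show "\<forall>\<^sub>F n in along I. prob_symmetric n (d n) < a"
    by (intro always_eventually allI) (rule le_less_trans)
qed

theorem theorem1p4:
  "(\<forall>(I :: nat set) (d :: nat \<Rightarrow> nat \<Rightarrow> nat).
      degree_family I d \<longrightarrow>
      little_omega (along I) (\<lambda>n. degree_count 1 n (d n)) (\<lambda>n. threshold1 n (d n)) \<or>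
      little_omega (along I) (\<lambda>n. degree_count 2 n (d n)) (\<lambda>n. threshold2 n (d n)) \<longrightarrow>
      ((\<lambda>n. prob_symmetric n (d n)) \<longlongrightarrow> 1) (along I))
   \<and>
   (\<forall>c::real. c > 0 \<longrightarrow>
      (\<exists>\<delta>::real. \<delta> > 0 \<and>
        (\<forall>(I :: nat set) (d :: nat \<Rightarrow> nat \<Rightarrow> nat).
           degree_family I d \<longrightarrow>
           (\<forall>n\<in>I. degree_count 1 n (d n) > c * threshold1 n (d n) \<or>
                  degree_count 2 n (d n) > c * threshold2 n (d n)) \<longrightarrow>
           (\<forall>\<^sub>F n in along I. prob_symmetric n (d n) > \<delta>))))"
proof (intro conjI allI impI)
  fix I :: "nat set" and d :: "nat \<Rightarrow> nat \<Rightarrow> nat"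
  assume fam: "degree_family I d"
    and om: "little_omega (along I) (\<lambda>n. degree_count 1 n (d n)) (\<lambda>n. threshold1 n (d n)) \<or>
      little_omega (along I) (\<lambda>n. degree_count 2 n (d n)) (\<lambda>n. threshold2 n (d n))"
  show "((\<lambda>n. prob_symmetric n (d n)) \<longlongrightarrow> 1) (along I)"
  proof (rule prob_symmetric_tendsto_1[OF fam])
    fix c :: real assume "0 < c"
    from om show "\<forall>\<^sub>F n in along I. degree_count 1 n (d n) > c * threshold1 n (d n) \<or>
        degree_count 2 n (d n) > c * threshold2 n (d n)"
      by (elim disjE)
        (auto dest!: little_omega_eventually_gt[OF _ \<open>0 < c\<close>] elim: eventually_mono)
  qed
next
  fix c :: real assume c: "0 < c"
  let ?r = "(c\<^sup>2 / 5000) / (1 + c\<^sup>2 / 5000)"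
  have r: "0 < ?r" using c by (intro divide_pos_pos add_pos_pos) simp_all
  show "\<exists>\<delta>::real. \<delta> > 0 \<and>
        (\<forall>(I :: nat set) (d :: nat \<Rightarrow> nat \<Rightarrow> nat).
           degree_family I d \<longrightarrow>
           (\<forall>n\<in>I. degree_count 1 n (d n) > c * threshold1 n (d n) \<or>
                  degree_count 2 n (d n) > c * threshold2 n (d n)) \<longrightarrow>
           (\<forall>\<^sub>F n in along I. prob_symmetric n (d n) > \<delta>))"
  \<comment> \<open>Halving turns the weak lower bound into a strict one. The value depends on
    \<open>c\<close> alone, so it serves all families at once.\<close>
  proof (intro exI[of _ "?r / 2"] conjI allI impI)
    show "0 < ?r / 2" using r by (rule half_gt_zero)
    fix I :: "nat set" and d :: "nat \<Rightarrow> nat \<Rightarrow> nat"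
    assume fam: "degree_family I d"
      and thr: "\<forall>n\<in>I. degree_count 1 n (d n) > c * threshold1 n (d n) \<or>
        degree_count 2 n (d n) > c * threshold2 n (d n)"
    have "\<forall>\<^sub>F n in along I. degree_count 1 n (d n) > c * threshold1 n (d n) \<or>
        degree_count 2 n (d n) > c * threshold2 n (d n)"
      unfolding along_def eventually_inf_principal using thr by simp
    from eventually_prob_symmetric_ge[OF fam c this]
    show "\<forall>\<^sub>F n in along I. prob_symmetric n (d n) > ?r / 2"
      by (rule eventually_mono) (use half_gt_zero[OF r] in linarith)
  qed
qed

end
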